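(* Let $\mathbb{F}_q$ be a finite field of characteristic $p$, let $a,b\in\mathbb{F}_q$ with $b\ne0$, and let $n\ge2$, $t\ge2$ be integers. Let $f_1,\dots,f_{t-1}\in\mathbb{F}_q[x]$ and let $C$ be the linear code over $\mathbb{F}_q$ with generator matrix $(I_n\ f_1(T_n(a,b,b))\ \cdots\ f_{t-1}(T_n(a,b,b)))$. Let $r$ be the largest integer such that $n+1=p^r(m+1)$ for an integer $m$. Then: (1) Assume $p=2$. If $r=1$, $f_1(a)+f_2(a)+\cdots+f_{t-1}(a)=1$, and $$f_1(a-b(\theta^i+\theta^{-i}))+\cdots+f_{t-1}(a-b(\theta^i+\theta^{-i}))\ne1\quad\text{for all } 1\le i\le \tfrac m2,$$ where $\theta$ is a primitive $(m+1)$-th root of $1$, then $C$ is a linear $[tn,n]$ code with one-dimensional Euclidean hull. (2) Assume $p$ is odd, let $\theta$ be a primitive $2(m+1)$-th root of $1$, and let $\mu\in\mathbb{F}_{q^2}$ with $\mu^2=-1$. (2a) Let $r=0$. If there is a unique $i$ ($1\le i\le m$) such that $$f_1(a-b(\theta^i+\theta^{-i}))^2+\cdots+f_{t-1}(a-b(\theta^i+\theta^{-i}))^2=-1,$$ then $C$ is a linear $[tn,n]$ code with one-dimensional Euclidean hull. In particular, when $t=2$, if there is a unique $i$ ($1\le i\le m$) such that $f_1(a-b(\theta^i+\theta^{-i}))\in\{\mu,-\mu\}$, then $C$ is a linear $[2n,n]$ code with one-dimensional Euclidean hull. (2b) Let $p=3$ and $r=1$. If there is a unique $x\in\{a-2b,a+2b\}$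 such that $f_1(x)^2+\cdots+f_{t-1}(x)^2=-1$, and $$f_1(a-b(\theta^i+\theta^{-i}))^2+\cdots+f_{t-1}(a-b(\theta^i+\theta^{-i}))^2\ne-1\quad\text{for all }1\le i\le m,$$ then $C$ is a linear $[tn,n]$ code with one-dimensional Euclidean hull. In particular, when $t=2$, if there is a unique $x\in\{a-2b,a+2b\}$ such that $f_1(x)\in\{\mu,-\mu\}$, and $f_1(a-b(\theta^i+\theta^{-i}))\notin\{\mu,-\mu\}$ for all $1\le i\le m$, then $C$ is a linear $[2n,n]$ code with one-dimensional Euclidean hull.
   Context: $T_n(a,b,c)$ denotes the $n\times n$ tridiagonal Toeplitz matrix with all diagonal entries equal to $a$, all subdiagonal entries equal to $b$, all superdiagonal entries equal to $c$, and all other entries $0$. $I_n$ is the identity matrix. Roots of unity are taken in an algebraic closure of $\mathbb{F}_q$. An $[N,K]$ linear code over $\mathbb{F}_q$ is a $K$-dimensional subspace $C$ of $\mathbb{F}_q^N$; its Euclidean dual is $C^{\perp_E}=\{y\in\mathbb{F}_q^N:\sum_i x_iy_i=0 \text{ for all } x\in C\}$ and its Euclidean hull is $C\cap C^{\perp_E}$. The code with generator matrix $G$ is the row space of $G$. *)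

theory Defs
  imports
    "Jordan_Normal_Form.VS_Connect"
    "HOL-Algebra.Algebraic_Closure_Type"
begin

definition tridiag_toeplitz :: "nat \<Rightarrow> 'a::zero \<Rightarrow> 'a \<Rightarrow> 'a \<Rightarrow> 'a mat" where
  "tridiag_toeplitz n a b c =
     mat n n (\<lambda>(i, j). if i = j then a
                       else if i = Suc j then b
                       else if j = Suc i then c
                       else 0)"

text \<open>The matrix $g(A) = \sum_k g_k A^k$ for a square matrix $A$, written entrywise because
  matrices of unspecified size have no zero to sum from.\<close>

definition poly_mat :: "'a::comm_ring_1 poly \<Rightarrow> 'a mat \<Rightarrow> 'a mat" where
  "poly_mat g A =
     mat (dim_row A) (dim_row A)
       (\<lambda>(i, j). \<Sum>k\<le>Polynomial.degree g. Polynomial.coeff g k * (A ^\<^sub>m k) $$ (i, j))"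

text \<open>The $n \times tn$ matrix $(I_n \; f_1(A) \; \cdots \; f_{t-1}(A))$, where $A$ is
  $n \times n$. Column \<open>j\<close> lies in block number \<open>j div n\<close>; the value \<open>f 0\<close> is not used.\<close>

definition gen_mat :: "nat \<Rightarrow> nat \<Rightarrow> (nat \<Rightarrow> 'a::comm_ring_1 poly) \<Rightarrow> 'a mat \<Rightarrow> 'a mat" where
  "gen_mat n t f A =
     mat n (t * n)
       (\<lambda>(i, j). if j div n = 0 then 1\<^sub>m n $$ (i, j)
                 else poly_mat (f (j div n)) A $$ (i, j mod n))"

definition generated_code :: "'a::field mat \<Rightarrow> 'a vec set" where
  "generated_code G = vec_space.row_space (dim_col G) G"

definition code_dim :: "nat \<Rightarrow> 'a::field vec set \<Rightarrow> nat" where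
  "code_dim N C =
     vectorspace.dim class_ring ((module_vec TYPE('a) N)\<lparr>carrier := C\<rparr>)"

definition linear_code :: "nat \<Rightarrow> nat \<Rightarrow> 'a::field vec set \<Rightarrow> bool" where
  "linear_code N K C \<longleftrightarrow>
     VectorSpace.subspace class_ring C (module_vec TYPE('a) N) \<and> code_dim N C = K"

definition euclidean_dual :: "nat \<Rightarrow> 'a::field vec set \<Rightarrow> 'a vec set" where
  "euclidean_dual N C = {y \<in> carrier_vec N. \<forall>x\<in>C. x \<bullet> y = 0}"

definition euclidean_hull :: "nat \<Rightarrow> 'a::field vec set \<Rightarrow> 'a vec set" where
  "euclidean_hull N C = C \<inter> euclidean_dual N C"

definition primitive_root_of_unity :: "nat \<Rightarrow> 'a::field \<Rightarrow> bool" where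
  "primitive_root_of_unity k z \<longleftrightarrow>
     0 < k \<and> z ^ k = 1 \<and> (\<forall>j. 0 < j \<and> j < k \<longrightarrow> z ^ j \<noteq> 1)"

text \<open>The subfield $\mathbb{F}_{q^2}$ of the algebraic closure of $\mathbb{F}_q$, as the set of
  roots of $X^{q^2} - X$.\<close>

definition quadratic_extension :: "'a::finite_field alg_closure set" where
  "quadratic_extension = {x. x ^ (card (UNIV :: 'a set) ^ 2) = x}"

definition eval_ac :: "'a::field poly \<Rightarrow> 'a alg_closure \<Rightarrow> 'a alg_closure" where
  "eval_ac g x = poly (map_poly to_ac g) x"

definition toeplitz_point :: "'a::field \<Rightarrow> 'a \<Rightarrow> 'a alg_closure \<Rightarrow> nat \<Rightarrow> 'a alg_closure" where
  "toeplitz_point a b \<theta> i = to_ac a - to_ac b * (\<theta> ^ i + inverse (\<theta> ^ i))"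

end

theory Submission
  imports Defs "Jordan_Normal_Form.DL_Rank" "Jordan_Normal_Form.Char_Poly"
begin

text \<open>
  Put $T = T_n(a,b,b)$, $G = (I\ f_1(T)\ \cdots\ f_{t-1}(T))$ and $g = 1 + \sum_j f_j^2$.
  As $T$ is symmetric, $G G^T = g(T)$, so the hull of $C$ is the image of $\ker g(T)$ under the
  injective map $v \mapsto G^T v$. Let $P_k$ be the polynomials with $P_k(T) e_0 = e_k$; then
  $P_n(T) = 0$, and $v_k = P_k(\lambda) v_0$ for every eigenvector $v$ of $T$ with eigenvalue
  $\lambda$, so eigenspaces are lines. Hence $\ker g(T)$ is a line as soon as $\gcd(g, P_n)$ is
  linear, that is, as soon as $g$ and $P_n$ have exactly one common root in the algebraic closure
  and that root is simple for $P_n$. Finally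
  $P_n(a - b(z + z^{-1}))(z - z^{-1}) = (-1)^n (z^{n+1} - z^{-(n+1)})$ exhibits the roots of $P_n$.
  They are simple for $r = 0$ because there are $n$ of them, and simplicity at $a \pm 2b$ follows
  from $b P_n'(a + 2be) = e^{n+1} \binom{n+2}{3}$ for $e = \pm 1$.
\<close>

section \<open>Common roots in the algebraic closure\<close>

text \<open>The cases of the theorem reflect root multiplicities. Up to the scalar b^n, P_n is the
  characteristic polynomial of T. With x = a - b(z + z^{-1}), a root x of P_n has z^(2(m+1)) = 1.
  For odd p the points with z^2 \<noteq> 1 have multiplicity p^r, and a + 2b and a - 2b have
  multiplicity (p^r - 1)/2. For p = 2 the points with z \<noteq> 1 have multiplicity 2^(r+1), and a
  has multiplicity 2^r - 1. So interior roots are simple only for odd p and r = 0, and endpoints are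
  simple roots only for p^r = 3 or p^r = 2. In each case the hypotheses keep g away from all roots
  of P_n but one simple root. At the endpoints z - z^{-1} vanishes and the identity for P_n carries
  no information, hence the separate computation of the derivative there.

  The common root is located in the closure, whereas the code lives over F_q. The Bezout identity is
  therefore formed over F_q: a generator of degree one forces the root into F_q, and T never has to
  be diagonalised.\<close>

interpretation to_ac: field_hom "to_ac :: 'a::field \<Rightarrow> 'a alg_closure"
  by unfold_locales simp_all

interpretation map_to_ac: map_poly_inj_idom_hom "to_ac :: 'a::field \<Rightarrow> 'a alg_closure" ..

lemma eval_ac_add [simp]: "eval_ac (g + h) x = eval_ac g x + eval_ac h x"
  by (simp add: eval_ac_def map_to_ac.hom_add)

lemma eval_ac_mult [simp]: "eval_ac (g * h) x = eval_ac g x * eval_ac h x"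
  by (simp add: eval_ac_def map_to_ac.hom_mult)

lemma eval_ac_power [simp]: "eval_ac (g ^ k) x = eval_ac g x ^ k"
  by (simp add: eval_ac_def map_to_ac.hom_power)

lemma eval_ac_sum: "eval_ac (sum h A) x = (\<Sum>j\<in>A. eval_ac (h j) x)"
  by (simp add: eval_ac_def map_to_ac.hom_sum poly_sum)

lemma eval_ac_to_ac [simp]: "eval_ac g (to_ac x) = to_ac (poly g x)"
  by (simp add: eval_ac_def)

lemma eval_ac_0 [simp]: "eval_ac 0 x = 0" and eval_ac_1 [simp]: "eval_ac 1 x = 1"
  by (simp_all add: eval_ac_def)

text \<open>A nonzero element of least degree in the ideal generated by \<open>g\<close> and
  \<open>h\<close> divides the whole ideal, because remainders stay in the ideal. All coefficients
  remain in the base field, so a matrix over that field can be substituted.\<close>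

lemma poly_ideal_generator:
  fixes g h :: "'a::field poly"
  assumes "h \<noteq> 0"
  obtains d u v where "d = u * g + v * h" "d \<noteq> 0" "d dvd g" "d dvd h"
proof -
  define I where "I = {d. d \<noteq> 0 \<and> (\<exists>u v. d = u * g + v * h)}"
  have "h = 0 * g + 1 * h" by simp
  with assms have "h \<in> I" unfolding I_def by blast
  then obtain d where d: "d \<in> I" and min: "\<And>e. e \<in> I \<Longrightarrow> Polynomial.degree d \<le> Polynomial.degree e"
    using ex_has_least_nat[of "\<lambda>d. d \<in> I" h Polynomial.degree] by blast
  from d obtain u v where uv: "d = u * g + v * h" and d0: "d \<noteq> 0" unfolding I_def by blast
  have dvd: "d dvd x * g + y * h" for x y
  proof (rule ccontr)
    assume "\<not> d dvd x * g + y * h"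
    define e where "e = (x * g + y * h) mod d"
    have e0: "e \<noteq> 0" using \<open>\<not> d dvd x * g + y * h\<close> by (simp add: e_def dvd_eq_mod_eq_0)
    have "e = x * g + y * h - (x * g + y * h) div d * d"
      by (simp add: e_def minus_div_mult_eq_mod)
    then have "e = (x - (x * g + y * h) div d * u) * g + (y - (x * g + y * h) div d * v) * h"
      unfolding uv by (simp add: algebra_simps)
    with e0 have "e \<in> I" unfolding I_def by blast
    moreover have "Polynomial.degree e < Polynomial.degree d"
      using degree_mod_less[OF d0, of "x * g + y * h"] e0 by (auto simp: e_def)
    ultimately show False using min by fastforce
  qed
  show thesis using that[OF uv d0] dvd[of 1 0] dvd[of 0 1] by simp
qed

text \<open>The generator \<open>d\<close> has \<open>x0\<close> as its only root in the closure. A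
  second factor \<open>X - x0\<close> of \<open>d\<close> would divide \<open>h\<close> as well and
  make \<open>pderiv h\<close> vanish at \<open>x0\<close>, so \<open>d\<close> is linear. Its root
  \<open>l\<close> therefore lies in the base field, although \<open>x0\<close> is only given in the
  closure.\<close>

lemma bezout_common_simple_root:
  fixes g h :: "'a::field poly"
  assumes roots: "\<And>x. eval_ac g x = 0 \<and> eval_ac h x = 0 \<longleftrightarrow> x = x0"
    and simple: "eval_ac (pderiv h) x0 \<noteq> 0"
  obtains u v l where "u * g + v * h = [:-l, 1:]" "poly g l = 0" "poly h l = 0"
proof -
  have "h \<noteq> 0" using simple by auto
  then obtain d u v where d: "d = u * g + v * h" "d \<noteq> 0" "d dvd g" "d dvd h"
    by (rule poly_ideal_generator)
  have droot: "eval_ac d x = 0 \<longleftrightarrow> x = x0" for x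
  proof
    assume "eval_ac d x = 0"
    then have "eval_ac g x = 0" "eval_ac h x = 0" using d(3,4) by (auto elim!: dvdE)
    then show "x = x0" using roots by blast
  next
    assume "x = x0"
    then show "eval_ac d x = 0" using roots[of x] d(1) by simp
  qed
  define dd where "dd = map_poly to_ac d"
  have "[:-x0, 1:] dvd dd" using droot[of x0] by (simp add: dd_def eval_ac_def poly_eq_0_iff_dvd)
  then obtain e where e: "dd = [:-x0, 1:] * e" by (elim dvdE)
  have "e \<noteq> 0" using e \<open>d \<noteq> 0\<close> by (auto simp: dd_def)
  have "poly e x0 \<noteq> 0"
  proof
    assume e0: "poly e x0 = 0"
    obtain c where c: "h = d * c" using d(4) by (elim dvdE)
    have "poly (pderiv dd) x0 = 0" unfolding e using e0 by (simp add: pderiv_mult del: mult_pCons_left)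
    then have "eval_ac (pderiv d) x0 = 0"
      by (simp add: dd_def eval_ac_def to_ac.map_poly_pderiv)
    then have "eval_ac (pderiv h) x0 = 0"
      using droot[of x0] by (simp add: c pderiv_mult)
    with simple show False by simp
  qed
  have "Polynomial.degree e = 0"
  proof (rule ccontr)
    assume "Polynomial.degree e \<noteq> 0"
    then obtain y where y: "poly e y = 0" using alg_closed_imp_poly_has_root[of e] by auto
    then have "eval_ac d y = 0" by (simp add: eval_ac_def dd_def[symmetric] e)
    then show False using droot y \<open>poly e x0 \<noteq> 0\<close> by auto
  qed
  then have "Polynomial.degree dd = 1" using \<open>e \<noteq> 0\<close> unfolding e by (subst degree_mult_eq) auto
  then have "Polynomial.degree d = 1" by (simp add: dd_def)
  then obtain c0 c1 where c: "d = [:c0, c1:]" "c1 \<noteq> 0"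
    by (metis One_nat_def degree_eq_zeroE degree_pCons_eq degree_pCons_0 nat.inject pCons_0_0
        pCons_cases zero_neq_one)
  define l where "l = - c0 / c1"
  have "poly d l = 0" using c by (simp add: l_def)
  then have "poly g l = 0" "poly h l = 0" using d(3,4) by (auto elim!: dvdE)
  \<comment> \<open>Division by the leading coefficient makes \<open>d\<close> monic; at a matrix,
    \<open>X - l\<close> becomes the eigenvector equation.\<close>
  moreover have "([:1 / c1:] * u) * g + ([:1 / c1:] * v) * h = [:1 / c1:] * d"
    unfolding d(1) by (simp add: algebra_simps smult_add_right)
  moreover have "[:1 / c1:] * d = [:-l, 1:]" using c by (simp add: l_def)
  ultimately show thesis using that[of "[:1 / c1:] * u" "[:1 / c1:] * v" l] by simp
qed

section \<open>The polynomials $P_k$\<close>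

text \<open>Chebyshev polynomials of the second kind, \<open>U_k((x - a) / (2 b))\<close>, written
  without the division by 2 so that characteristic 2 is covered. For \<open>b \<noteq> 0\<close>,
  multiplying by \<open>b ^ k\<close> gives the characteristic polynomial of the Toeplitz matrix of
  size \<open>k\<close>.\<close>

fun toeplitz_poly :: "'a::field \<Rightarrow> 'a \<Rightarrow> nat \<Rightarrow> 'a poly" where
  "toeplitz_poly a b 0 = 1"
| "toeplitz_poly a b (Suc 0) = [:- a / b, 1 / b:]"
| "toeplitz_poly a b (Suc (Suc k)) =
     [:- a / b, 1 / b:] * toeplitz_poly a b (Suc k) - toeplitz_poly a b k"

lemma map_poly_toeplitz_poly:
  "map_poly to_ac (toeplitz_poly a b k) = toeplitz_poly (to_ac a) (to_ac b) k"
  by (induction a b k rule: toeplitz_poly.induct)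
     (simp_all del: mult_pCons_left add: map_to_ac.hom_minus map_to_ac.hom_mult
        to_ac.map_poly_pCons_hom)

lemma degree_toeplitz_poly:
  assumes "b \<noteq> 0"
  shows "Polynomial.degree (toeplitz_poly a b k) = k"
  using assms
proof (induction a b k rule: toeplitz_poly.induct)
  case (3 a b k)
  then have "toeplitz_poly a b (Suc k) \<noteq> 0" by auto
  with 3 have "Polynomial.degree ([:- a / b, 1 / b:] * toeplitz_poly a b (Suc k)) = Suc (Suc k)"
    by (subst degree_mult_eq) auto
  then show ?case using 3 unfolding toeplitz_poly.simps(3)
    by (subst diff_conv_add_uminus, subst degree_add_eq_left) simp_all
qed auto

text \<open>Algebraic form of \<open>U_k(cos s) * sin s = sin((k + 1) s)\<close>; the sign comes
  from the minus in \<open>a - b * (z + inverse z)\<close>. Keeping \<open>z - inverse z\<close> as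
  a factor on the left avoids excluding \<open>z = 1\<close> and \<open>z = -1\<close>.\<close>

lemma poly_toeplitz_poly_param:
  fixes a b z :: "'a::field"
  assumes "b \<noteq> 0" "z \<noteq> 0"
  shows "poly (toeplitz_poly a b k) (a - b * (z + inverse z)) * (z - inverse z) =
    (-1) ^ k * (z ^ Suc k - inverse z ^ Suc k)"
  using assms
proof (induction a b k rule: toeplitz_poly.induct)
  case (3 a b k)
  let ?x = "a - b * (z + inverse z)"
  have inv: "z * (inverse z * w) = w" for w
    using 3 by (simp flip: mult.assoc)
  have "poly [:- a / b, 1 / b:] ?x = - (z + inverse z)"
    using 3 by (simp add: field_simps)
  then have "poly (toeplitz_poly a b (Suc (Suc k))) ?x * (z - inverse z) =
    - (z + inverse z) * (poly (toeplitz_poly a b (Suc k)) ?x * (z - inverse z))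
    - poly (toeplitz_poly a b k) ?x * (z - inverse z)"
    unfolding toeplitz_poly.simps(3) poly_diff poly_mult left_diff_distrib by simp
  also have "\<dots> = (-1) ^ Suc (Suc k) *
    ((z + inverse z) * (z ^ Suc (Suc k) - inverse z ^ Suc (Suc k)) - (z ^ Suc k - inverse z ^ Suc k))"
    unfolding 3(1)[OF 3(3,4)] 3(2)[OF 3(3,4)] by (simp add: algebra_simps)
  also have "(z + inverse z) * (z ^ Suc (Suc k) - inverse z ^ Suc (Suc k)) - (z ^ Suc k - inverse z ^ Suc k)
      = z ^ Suc (Suc (Suc k)) - inverse z ^ Suc (Suc (Suc k))"
    by (simp add: algebra_simps inv mult.left_commute[of "inverse z" z])
  finally show ?case .
next
  case (2 a b)
  then have lin: "poly [:- a / b, 1 / b:] (a - b * (z + inverse z)) = - (z + inverse z)"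
    by (simp add: field_simps)
  show ?case unfolding toeplitz_poly.simps lin by (simp add: algebra_simps)
qed auto

text \<open>These are the points where the parametrised identity reads \<open>0 = 0\<close>, so the
  recursion is evaluated directly. The binomial coefficient is the division-free form of
  \<open>k (k + 1) (k + 2) / 6\<close>, meaningful also in characteristic 2 and 3; the factor
  \<open>b\<close> clears the slope \<open>1 / b\<close>.\<close>

lemma poly_toeplitz_poly_endpoint:
  fixes a b e :: "'a::field"
  assumes "b \<noteq> 0" "e * e = 1"
  shows "poly (toeplitz_poly a b k) (a + 2 * b * e) = e ^ k * of_nat (Suc k)"
    and "b * poly (pderiv (toeplitz_poly a b k)) (a + 2 * b * e) = e ^ Suc k * of_nat (Suc (Suc k) choose 3)"
proof -
  have lin: "poly [:- a / b, 1 / b:] (a + 2 * b * e) = 2 * e"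
    using assms by (simp add: field_simps)
  show *: "poly (toeplitz_poly a b k) (a + 2 * b * e) = e ^ k * of_nat (Suc k)" for k
    using assms lin
  proof (induction a b k rule: toeplitz_poly.induct)
    case (3 a b k)
    have ee: "e * (e * w) = w" for w using 3(4) by (simp flip: mult.assoc)
    then show ?case using 3 unfolding toeplitz_poly.simps(3) poly_diff poly_mult
      by (simp add: algebra_simps ee)
  qed auto
  \<comment> \<open>The second difference of \<open>x choose 3\<close> is \<open>x\<close>, taken
    here at \<open>x = k + 2\<close>. This matches the term \<open>P_(k+1)\<close> that
    differentiating the recursion adds.\<close>
  have ch: "(Suc (Suc (Suc (Suc k))) choose 3) + (Suc (Suc k) choose 3)
      = Suc (Suc k) + 2 * (Suc (Suc (Suc k)) choose 3)" for k
    by (simp add: numeral_eq_Suc)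
  show "b * poly (pderiv (toeplitz_poly a b k)) (a + 2 * b * e) = e ^ Suc k * of_nat (Suc (Suc k) choose 3)"
    using assms lin *
  proof (induction a b k rule: toeplitz_poly.induct)
    case (3 a b k)
    let ?x = "a + 2 * b * e" and ?C = "\<lambda>k. of_nat (Suc (Suc k) choose 3) :: 'a"
    have "b * poly (pderiv (toeplitz_poly a b (Suc (Suc k)))) ?x =
      poly (toeplitz_poly a b (Suc k)) ?x + 2 * e * (b * poly (pderiv (toeplitz_poly a b (Suc k))) ?x)
      - b * poly (pderiv (toeplitz_poly a b k)) ?x"
      unfolding toeplitz_poly.simps(3) pderiv_diff pderiv_mult poly_diff poly_mult poly_add 3(5)
      using 3(3) by (simp add: pderiv_pCons algebra_simps)
    also have "\<dots> = e ^ Suc k * of_nat (Suc (Suc k)) + 2 * e * (e ^ Suc (Suc k) * ?C (Suc k)) - e ^ Suc k * ?C k"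
      using 3 by simp
    also have "\<dots> = e ^ Suc k * (of_nat (Suc (Suc k)) + 2 * ?C (Suc k) - ?C k)"
      using 3(4) by (simp add: algebra_simps)
    also have "of_nat (Suc (Suc k)) + 2 * ?C (Suc k) - ?C k = ?C (Suc (Suc k))"
      using arg_cong[OF ch[of k], of "of_nat :: nat \<Rightarrow> 'a"] by (simp only: of_nat_add of_nat_mult) (simp add: algebra_simps)
    also have "e ^ Suc k = e ^ Suc (Suc (Suc k))" using 3(4) by (simp add: algebra_simps)
    finally show ?case .
  qed (auto simp: pderiv_pCons numeral_eq_Suc)
qed

section \<open>Polynomials in a matrix\<close>

lemma smult_mat_mult_mat_vec_assoc:
  fixes A :: "'a::comm_ring_1 mat"
  assumes "A \<in> carrier_mat nr nc" "v \<in> carrier_vec nc"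
  shows "(c \<cdot>\<^sub>m A) *\<^sub>v v = c \<cdot>\<^sub>v (A *\<^sub>v v)"
  using assms by (intro eq_vecI) auto

lemma poly_mat_carrier [simp]:
  "A \<in> carrier_mat n n \<Longrightarrow> poly_mat g A \<in> carrier_mat n n"
  by (auto simp: poly_mat_def)

lemma dim_poly_mat [simp]:
  "dim_row (poly_mat g A) = dim_row A" "dim_col (poly_mat g A) = dim_row A"
  by (auto simp: poly_mat_def)

text \<open>Coefficients beyond the degree vanish, so polynomials of different degrees can be
  compared over one common range of summation, even when a degree drops in a sum.\<close>

lemma poly_mat_index:
  assumes "A \<in> carrier_mat n n" "i < n" "j < n" "Polynomial.degree g \<le> N"
  shows "poly_mat g A $$ (i, j) = (\<Sum>k\<le>N. Polynomial.coeff g k * (A ^\<^sub>m k) $$ (i, j))"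
proof -
  have "poly_mat g A $$ (i, j) =
      (\<Sum>k\<le>Polynomial.degree g. Polynomial.coeff g k * (A ^\<^sub>m k) $$ (i, j))"
    using assms by (simp add: poly_mat_def)
  also have "\<dots> = (\<Sum>k\<le>N. Polynomial.coeff g k * (A ^\<^sub>m k) $$ (i, j))"
    using assms(4) by (intro sum.mono_neutral_left) (auto simp: coeff_eq_0)
  finally show ?thesis .
qed

lemma poly_mat_add:
  assumes A: "A \<in> carrier_mat n n"
  shows "poly_mat (g + h) A = poly_mat g A + poly_mat h A"
proof (rule eq_matI)
  fix i j assume "i < dim_row (poly_mat g A + poly_mat h A)" "j < dim_col (poly_mat g A + poly_mat h A)"
  then have ij: "i < n" "j < n" using A by auto
  define N where "N = max (Polynomial.degree g) (Polynomial.degree h)"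
  have "Polynomial.degree (g + h) \<le> N" unfolding N_def by (rule degree_add_le_max)
  then show "poly_mat (g + h) A $$ (i, j) = (poly_mat g A + poly_mat h A) $$ (i, j)"
    using ij A poly_mat_index[OF A ij, of _ N]
    by (simp add: N_def sum.distrib distrib_right)
qed (use A in auto)

lemma poly_mat_smult:
  assumes A: "A \<in> carrier_mat n n"
  shows "poly_mat (Polynomial.smult c g) A = c \<cdot>\<^sub>m poly_mat g A"
proof (rule eq_matI)
  fix i j assume "i < dim_row (c \<cdot>\<^sub>m poly_mat g A)" "j < dim_col (c \<cdot>\<^sub>m poly_mat g A)"
  then have ij: "i < n" "j < n" using A by auto
  show "poly_mat (Polynomial.smult c g) A $$ (i, j) = (c \<cdot>\<^sub>m poly_mat g A) $$ (i, j)"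
    using ij A poly_mat_index[OF A ij, of _ "Polynomial.degree g"]
    by (simp add: degree_smult_le sum_distrib_left mult.assoc)
qed (use A in auto)

lemma poly_mat_0: "A \<in> carrier_mat n n \<Longrightarrow> poly_mat 0 A = 0\<^sub>m n n"
  by (rule eq_matI) (auto simp: poly_mat_def)

text \<open>Horner step, with \<open>A\<close> on the right as in the recursion of matrix powers. It
  replaces the entrywise definition in the inductions on polynomials below.\<close>

lemma poly_mat_pCons:
  assumes A: "A \<in> carrier_mat n n"
  shows "poly_mat (pCons c g) A = c \<cdot>\<^sub>m 1\<^sub>m n + poly_mat g A * A"
proof (rule eq_matI)
  fix i j
  assume "i < dim_row (c \<cdot>\<^sub>m 1\<^sub>m n + poly_mat g A * A)" "j < dim_col (c \<cdot>\<^sub>m 1\<^sub>m n + poly_mat g A * A)"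
  then have ij: "i < n" "j < n" using A by auto
  have pow: "(A ^\<^sub>m k) \<in> carrier_mat n n" for k using A by simp
  define N where "N = Polynomial.degree g"
  have "poly_mat (pCons c g) A $$ (i, j) =
      (\<Sum>k\<le>Suc N. Polynomial.coeff (pCons c g) k * (A ^\<^sub>m k) $$ (i, j))"
    using ij A by (intro poly_mat_index[OF A]) (auto simp: N_def degree_pCons_le)
  also have "\<dots> = c * 1\<^sub>m n $$ (i, j) +
      (\<Sum>k\<le>N. Polynomial.coeff g k * (\<Sum>l = 0..<n. (A ^\<^sub>m k) $$ (i, l) * A $$ (l, j)))"
    unfolding sum.atMost_Suc_shift using A ij pow
    by (simp add: scalar_prod_def)
  also have "(\<Sum>k\<le>N. Polynomial.coeff g k * (\<Sum>l = 0..<n. (A ^\<^sub>m k) $$ (i, l) * A $$ (l, j))) =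
      (\<Sum>l = 0..<n. (\<Sum>k\<le>N. Polynomial.coeff g k * (A ^\<^sub>m k) $$ (i, l)) * A $$ (l, j))"
    unfolding sum_distrib_left sum_distrib_right by (subst sum.swap) (simp add: mult.assoc)
  also have "\<dots> = (poly_mat g A * A) $$ (i, j)"
    using A ij poly_mat_index[OF A ij(1), of _ g N] by (simp add: scalar_prod_def N_def)
  finally show "poly_mat (pCons c g) A $$ (i, j) = (c \<cdot>\<^sub>m 1\<^sub>m n + poly_mat g A * A) $$ (i, j)"
    using ij A by simp
qed (use A in auto)

lemma poly_mat_1: "A \<in> carrier_mat n n \<Longrightarrow> poly_mat 1 A = 1\<^sub>m n"
  by (rule eq_matI) (auto simp: poly_mat_def)

lemma poly_mat_commute:
  assumes A: "A \<in> carrier_mat n n"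
  shows "A * poly_mat g A = poly_mat g A * A"
proof (induction g)
  case 0
  then show ?case using A by (simp add: poly_mat_0)
next
  case (pCons c g)
  have P: "poly_mat g A \<in> carrier_mat n n" using A by simp
  have "A * poly_mat (pCons c g) A = A * (c \<cdot>\<^sub>m 1\<^sub>m n) + A * (poly_mat g A * A)"
    unfolding poly_mat_pCons[OF A] using A P by (intro mult_add_distrib_mat) auto
  also have "A * (c \<cdot>\<^sub>m 1\<^sub>m n) = c \<cdot>\<^sub>m 1\<^sub>m n * A"
    using A by (simp add: mult_smult_distrib[OF A, of "1\<^sub>m n" n] mult_smult_assoc_mat[of _ n n])
  also have "A * (poly_mat g A * A) = poly_mat g A * A * A"
    using A P pCons.IH by (metis assoc_mult_mat)
  also have "c \<cdot>\<^sub>m 1\<^sub>m n * A + poly_mat g A * A * A = poly_mat (pCons c g) A * A"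
    unfolding poly_mat_pCons[OF A] using A P by (intro add_mult_distrib_mat[symmetric]) auto
  finally show ?case .
qed

lemma poly_mat_mult:
  assumes A: "A \<in> carrier_mat n n"
  shows "poly_mat (g * h) A = poly_mat g A * poly_mat h A"
proof (induction g)
  case 0
  then show ?case using A by (simp add: poly_mat_0 poly_mat_carrier[OF A])
next
  case (pCons c g)
  have P: "poly_mat g A \<in> carrier_mat n n" "poly_mat h A \<in> carrier_mat n n" using A by auto
  have zero: "0 \<cdot>\<^sub>m 1\<^sub>m n + M = M" if "M \<in> carrier_mat n n" for M :: "'a mat"
    using that by (intro eq_matI) auto
  have "poly_mat (pCons c g * h) A = c \<cdot>\<^sub>m poly_mat h A + (0 \<cdot>\<^sub>m 1\<^sub>m n + poly_mat (g * h) A * A)"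
    unfolding mult_pCons_left poly_mat_add[OF A] poly_mat_smult[OF A] poly_mat_pCons[OF A] ..
  also have "0 \<cdot>\<^sub>m 1\<^sub>m n + poly_mat (g * h) A * A = poly_mat g A * A * poly_mat h A"
    using A P pCons.IH poly_mat_commute[OF A, of h] zero[of "poly_mat g A * (poly_mat h A * A)"]
    by (simp add: assoc_mult_mat[OF P(1) P(2) A] assoc_mult_mat[OF P(1) A P(2)]
        mult_carrier_mat[OF A P(2)] mult_carrier_mat[of _ n n])
  also have "c \<cdot>\<^sub>m poly_mat h A + poly_mat g A * A * poly_mat h A = poly_mat (pCons c g) A * poly_mat h A"
    unfolding poly_mat_pCons[OF A] using A P
    by (subst add_mult_distrib_mat[of _ n n]) (auto simp: mult_smult_assoc_mat[of _ n n])
  finally show ?case .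
qed

lemma poly_mat_linear:
  assumes A: "A \<in> carrier_mat n n"
  shows "poly_mat [:c, d:] A = c \<cdot>\<^sub>m 1\<^sub>m n + d \<cdot>\<^sub>m A"
proof -
  have "poly_mat [:c, d:] A = c \<cdot>\<^sub>m 1\<^sub>m n + (d \<cdot>\<^sub>m 1\<^sub>m n + 0\<^sub>m n n * A) * A"
    by (simp add: poly_mat_pCons[OF A] poly_mat_0[OF A])
  also have "(d \<cdot>\<^sub>m 1\<^sub>m n + 0\<^sub>m n n * A) * A = d \<cdot>\<^sub>m A"
    using A by (simp add: mult_smult_assoc_mat[of _ n n])
  finally show ?thesis .
qed

lemma poly_mat_sum_index:
  assumes A: "A \<in> carrier_mat n n" and "i < n" "j < n"
  shows "poly_mat (sum h S) A $$ (i, j) = (\<Sum>s\<in>S. poly_mat (h s) A $$ (i, j))"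
  using assms by (induction S rule: infinite_finite_induct)
    (auto simp: poly_mat_0[OF A] poly_mat_add[OF A])

lemma transpose_smult_mat: "transpose_mat (c \<cdot>\<^sub>m A) = c \<cdot>\<^sub>m transpose_mat A"
  by (rule eq_matI) auto

lemma transpose_poly_mat:
  assumes A: "A \<in> carrier_mat n n" and sym: "transpose_mat A = A"
  shows "transpose_mat (poly_mat g A) = poly_mat g A"
proof (induction g)
  case 0
  then show ?case using A by (simp add: poly_mat_0)
next
  case (pCons c g)
  have P: "poly_mat g A \<in> carrier_mat n n" using A by simp
  have "transpose_mat (poly_mat (pCons c g) A) =
      c \<cdot>\<^sub>m 1\<^sub>m n + transpose_mat A * transpose_mat (poly_mat g A)"
    unfolding poly_mat_pCons[OF A] using A P
    by (subst transpose_add[of _ n n]) (auto simp: transpose_mult[OF P A] transpose_smult_mat)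
  then show ?case by (simp add: sym pCons.IH poly_mat_commute[OF A] poly_mat_pCons[OF A])
qed

lemma poly_mat_eigenvector:
  fixes A :: "'a::field mat"
  assumes A: "A \<in> carrier_mat n n" and v: "v \<in> carrier_vec n"
    and eig: "A *\<^sub>v v = l \<cdot>\<^sub>v v"
  shows "poly_mat g A *\<^sub>v v = poly g l \<cdot>\<^sub>v v"
proof (induction g)
  case 0
  then show ?case using v by (auto simp: poly_mat_0[OF A])
next
  case (pCons c g)
  have P: "poly_mat g A \<in> carrier_mat n n" using A by simp
  have "poly_mat (pCons c g) A *\<^sub>v v = (c \<cdot>\<^sub>m 1\<^sub>m n) *\<^sub>v v + (poly_mat g A * A) *\<^sub>v v"
    unfolding poly_mat_pCons[OF A] using A P v by (intro add_mult_distrib_mat_vec) auto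
  also have "(c \<cdot>\<^sub>m 1\<^sub>m n) *\<^sub>v v = c \<cdot>\<^sub>v v"
    using v by (simp add: smult_mat_mult_mat_vec_assoc[of _ n n])
  also have "(poly_mat g A * A) *\<^sub>v v = l \<cdot>\<^sub>v (poly g l \<cdot>\<^sub>v v)"
    using P A v by (simp add: assoc_mult_mat_vec[of _ n n] eig mult_mat_vec[OF P v] pCons.IH)
  finally show ?case using v by (simp add: add_smult_distrib_vec smult_smult_assoc)
qed

section \<open>Tridiagonal Toeplitz matrices\<close>

lemma tridiag_toeplitz_carrier [simp]: "tridiag_toeplitz n a b c \<in> carrier_mat n n"
  by (simp add: tridiag_toeplitz_def)

lemma dim_tridiag_toeplitz [simp]:
  "dim_row (tridiag_toeplitz n a b c) = n" "dim_col (tridiag_toeplitz n a b c) = n"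
  by (simp_all add: tridiag_toeplitz_def)

lemma transpose_tridiag_toeplitz: "transpose_mat (tridiag_toeplitz n a b c) = tridiag_toeplitz n a c b"
  by (rule eq_matI) (auto simp: tridiag_toeplitz_def)

lemma tridiag_toeplitz_mult_vec_index:
  fixes w :: "'a::comm_ring_1 vec"
  assumes w: "w \<in> carrier_vec n" and i: "i < n"
  shows "(tridiag_toeplitz n a b c *\<^sub>v w) $ i =
    a * w $ i + (if i = 0 then 0 else b * w $ (i - 1)) + (if Suc i < n then c * w $ Suc i else 0)"
proof -
  have entry: "tridiag_toeplitz n a b c $$ (i, j) * w $ j =
      (if j = i then a * w $ j else 0) + (if Suc j = i then b * w $ j else 0)
      + (if j = Suc i then c * w $ j else 0)" if "j \<in> {0..<n}" for j
    using i that by (auto simp: tridiag_toeplitz_def)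
  have "(tridiag_toeplitz n a b c *\<^sub>v w) $ i = (\<Sum>j = 0..<n. tridiag_toeplitz n a b c $$ (i, j) * w $ j)"
    using w i by (simp add: scalar_prod_def)
  also have "\<dots> = (\<Sum>j = 0..<n. if j = i then a * w $ j else 0)
      + (\<Sum>j = 0..<n. if Suc j = i then b * w $ j else 0)
      + (\<Sum>j = 0..<n. if j = Suc i then c * w $ j else 0)"
    unfolding sum.distrib[symmetric] by (rule sum.cong[OF refl entry])
  also have "(\<Sum>j = 0..<n. if j = i then a * w $ j else 0) = a * w $ i"
    using i by simp
  also have "(\<Sum>j = 0..<n. if Suc j = i then b * w $ j else 0) = (if i = 0 then 0 else b * w $ (i - 1))"
  proof (cases i)
    case (Suc k)
    then show ?thesis using i by simp
  qed simp
  also have "(\<Sum>j = 0..<n. if j = Suc i then c * w $ j else 0) = (if Suc i < n then c * w $ Suc i else 0)"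
    by simp
  finally show ?thesis .
qed

text \<open>\<open>(T - a) / b\<close> is the adjacency matrix of a path, so it sends a vertex to
  the sum of its neighbours. The right end needs no case of its own: \<open>unit_vec n n\<close> is
  the zero vector.\<close>

lemma tridiag_toeplitz_shift_unit_vec:
  fixes a b :: "'a::field"
  assumes b: "b \<noteq> 0" and k: "k < n"
  shows "poly_mat [:- a / b, 1 / b:] (tridiag_toeplitz n a b b) *\<^sub>v unit_vec n k =
    (if k = 0 then 0\<^sub>v n else unit_vec n (k - 1)) + unit_vec n (Suc k)"
proof (rule eq_vecI)
  let ?T = "tridiag_toeplitz n a b b"
  have T: "?T \<in> carrier_mat n n" by simp
  fix i assume "i < dim_vec ((if k = 0 then 0\<^sub>v n else unit_vec n (k - 1)) + unit_vec n (Suc k) :: 'a vec)"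
  then have i: "i < n" by simp
  have "poly_mat [:- a / b, 1 / b:] ?T *\<^sub>v unit_vec n k
      = (- a / b) \<cdot>\<^sub>v unit_vec n k + (1 / b) \<cdot>\<^sub>v (?T *\<^sub>v unit_vec n k)"
    unfolding poly_mat_linear[OF T] using T
    by (subst add_mult_distrib_mat_vec[of _ n n]) (auto simp: smult_mat_mult_mat_vec_assoc[of _ n n])
  then have "(poly_mat [:- a / b, 1 / b:] ?T *\<^sub>v unit_vec n k) $ i
      = (- a / b) * unit_vec n k $ i + (1 / b) * (?T *\<^sub>v unit_vec n k) $ i"
    using i by (simp del: index_mult_mat_vec)
  also have "\<dots> = ((if k = 0 then 0\<^sub>v n else unit_vec n (k - 1)) + unit_vec n (Suc k)) $ i"
    unfolding tridiag_toeplitz_mult_vec_index[OF unit_vec_carrier i]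
    using i b k by (auto simp: unit_vec_def)
  finally show "(poly_mat [:- a / b, 1 / b:] ?T *\<^sub>v unit_vec n k) $ i
      = ((if k = 0 then 0\<^sub>v n else unit_vec n (k - 1)) + unit_vec n (Suc k)) $ i" .
qed simp

lemma toeplitz_poly_mult_unit_vec:
  fixes a b :: "'a::field"
  assumes "b \<noteq> 0" "0 < n" "k \<le> n"
  shows "poly_mat (toeplitz_poly a b k) (tridiag_toeplitz n a b b) *\<^sub>v unit_vec n 0 = unit_vec n k"
  using assms
proof (induction a b k rule: toeplitz_poly.induct)
  case (1 a b)
  then show ?case by (simp add: poly_mat_1[of _ n])
next
  case (2 a b)
  then show ?case using tridiag_toeplitz_shift_unit_vec[of b 0 n a] by simp
next
  case (3 a b k)
  let ?T = "tridiag_toeplitz n a b b" and ?L = "[:- a / b, 1 / b:]"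
  have T: "?T \<in> carrier_mat n n" by simp
  let ?P = "poly_mat (toeplitz_poly a b (Suc k)) ?T" and ?Q = "poly_mat (toeplitz_poly a b k) ?T"
  have PQ: "?P \<in> carrier_mat n n" "?Q \<in> carrier_mat n n" "poly_mat ?L ?T \<in> carrier_mat n n"
    using T by (auto intro: poly_mat_carrier)
  have rec: "toeplitz_poly a b (Suc (Suc k)) =
      ?L * toeplitz_poly a b (Suc k) + Polynomial.smult (-1) (toeplitz_poly a b k)"
    by simp
  have "poly_mat (toeplitz_poly a b (Suc (Suc k))) ?T *\<^sub>v unit_vec n 0
      = (poly_mat ?L ?T * ?P) *\<^sub>v unit_vec n 0 + ((-1) \<cdot>\<^sub>m ?Q) *\<^sub>v unit_vec n 0"
    unfolding rec poly_mat_add[OF T] poly_mat_mult[OF T] poly_mat_smult[OF T] using PQ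
    by (intro add_mult_distrib_mat_vec[of _ n n]) auto
  also have "(poly_mat ?L ?T * ?P) *\<^sub>v unit_vec n 0 = poly_mat ?L ?T *\<^sub>v (?P *\<^sub>v unit_vec n 0)"
    using PQ by (intro assoc_mult_mat_vec) auto
  also have "?P *\<^sub>v unit_vec n 0 = unit_vec n (Suc k)" using 3 by simp
  also have "((-1) \<cdot>\<^sub>m ?Q) *\<^sub>v unit_vec n 0 = (-1) \<cdot>\<^sub>v (?Q *\<^sub>v unit_vec n 0)"
    using PQ by (intro smult_mat_mult_mat_vec_assoc) auto
  also have "?Q *\<^sub>v unit_vec n 0 = unit_vec n k" using 3 by simp
  also have "poly_mat ?L ?T *\<^sub>v unit_vec n (Suc k) = unit_vec n k + unit_vec n (Suc (Suc k))"
    using 3 by (subst tridiag_toeplitz_shift_unit_vec) simp_all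
  also have "unit_vec n k + unit_vec n (Suc (Suc k)) + (-1) \<cdot>\<^sub>v unit_vec n k
      = (unit_vec n (Suc (Suc k)) :: 'a vec)"
    by (intro eq_vecI) (auto simp: unit_vec_def)
  finally show ?case .
qed

text \<open>The first unit vector is cyclic: the polynomials \<open>P_k\<close> carry it to every
  other unit vector. Since \<open>P_n(T)\<close> kills it and commutes with each
  \<open>P_k(T)\<close>, it kills them all.\<close>

lemma toeplitz_poly_annihilates:
  fixes a b :: "'a::field"
  assumes b: "b \<noteq> 0" and n: "0 < n"
  shows "poly_mat (toeplitz_poly a b n) (tridiag_toeplitz n a b b) = 0\<^sub>m n n"
proof -
  let ?T = "tridiag_toeplitz n a b b" and ?p = "toeplitz_poly a b"
  have T: "?T \<in> carrier_mat n n" by simp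
  let ?M = "poly_mat (?p n) ?T"
  have M: "?M \<in> carrier_mat n n" using T by (rule poly_mat_carrier)
  have "col ?M k = 0\<^sub>v n" if "k < n" for k
  proof -
    have P: "poly_mat (?p k) ?T \<in> carrier_mat n n" using T by (rule poly_mat_carrier)
    have "col ?M k = ?M *\<^sub>v unit_vec n k" using M that by (intro eq_vecI) auto
    also have "unit_vec n k = poly_mat (?p k) ?T *\<^sub>v unit_vec n 0"
      using b n that by (simp add: toeplitz_poly_mult_unit_vec)
    also have "?M *\<^sub>v \<dots> = (?M * poly_mat (?p k) ?T) *\<^sub>v unit_vec n 0"
      using M P by (intro assoc_mult_mat_vec[symmetric]) auto
    also have "?M * poly_mat (?p k) ?T = poly_mat (?p k) ?T * ?M"
      unfolding poly_mat_mult[OF T, symmetric] by (simp only: mult.commute)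
    also have "(poly_mat (?p k) ?T * ?M) *\<^sub>v unit_vec n 0 = poly_mat (?p k) ?T *\<^sub>v (?M *\<^sub>v unit_vec n 0)"
      using M P by (intro assoc_mult_mat_vec) auto
    also have "?M *\<^sub>v unit_vec n 0 = 0\<^sub>v n"
      using toeplitz_poly_mult_unit_vec[OF b n order_refl] by (auto simp: unit_vec_def)
    finally show ?thesis using P by auto
  qed
  then show ?thesis using M by (intro mat_col_eqI) auto
qed

text \<open>Row \<open>k\<close> of the eigenvector equation determines entry \<open>k + 1\<close>
  from the two entries before it, by the recursion defining the polynomials.\<close>

lemma tridiag_toeplitz_eigenvector_unique:
  fixes a b :: "'a::field" and w :: "'a vec"
  assumes b: "b \<noteq> 0" and w: "w \<in> carrier_vec n" and eig: "tridiag_toeplitz n a b b *\<^sub>v w = l \<cdot>\<^sub>v w"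
    and "k < n"
  shows "w $ k = w $ 0 * poly (toeplitz_poly a b k) l"
  using \<open>k < n\<close>
proof (induction k rule: induct_nat_012)
  case 1
  have "a * w $ 0 + b * w $ 1 = l * w $ 0"
    using tridiag_toeplitz_mult_vec_index[OF w, of 0 a b b] 1 w by (simp add: eig)
  then show ?case using b by (simp add: field_simps)
next
  case (ge2 k)
  have "a * w $ Suc k + b * w $ k + b * w $ Suc (Suc k) = l * w $ Suc k"
    using tridiag_toeplitz_mult_vec_index[OF w, of "Suc k" a b b] ge2 w by (simp add: eig)
  then have "w $ Suc (Suc k) = (l - a) / b * w $ Suc k - w $ k"
    using b by (simp add: field_simps)
  also have "\<dots> = w $ 0 * poly (toeplitz_poly a b (Suc (Suc k))) l"
    using ge2 b unfolding toeplitz_poly.simps(3) poly_diff poly_mult by (simp add: field_simps)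
  finally show ?case .
qed simp

lemma tridiag_toeplitz_eigenvector:
  fixes a b :: "'a::field"
  assumes b: "b \<noteq> 0" and n: "0 < n" and root: "poly (toeplitz_poly a b n) l = 0"
  defines "u \<equiv> vec n (\<lambda>k. poly (toeplitz_poly a b k) l)"
  shows "tridiag_toeplitz n a b b *\<^sub>v u = l \<cdot>\<^sub>v u"
proof (rule eq_vecI)
  let ?p = "\<lambda>k. poly (toeplitz_poly a b k) l"
  fix i assume "i < dim_vec (l \<cdot>\<^sub>v u)"
  then have i: "i < n" by (simp add: u_def)
  have rec: "b * ?p (Suc k) = (l - a) * ?p k - (if k = 0 then 0 else b * ?p (k - 1))" for k
  proof (cases k)
    case (Suc j)
    then show ?thesis using b unfolding Suc toeplitz_poly.simps(3) poly_diff poly_mult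
      by (simp add: field_simps)
  qed (use b in \<open>simp add: field_simps\<close>)
  \<comment> \<open>In the last row the missing neighbour would be \<open>P_n(l)\<close>; this is
    the place where \<open>l\<close> must be a root.\<close>
  have "(if Suc i < n then b * u $ Suc i else 0) = b * ?p (Suc i)"
    using i root by (cases "Suc i = n") (auto simp: u_def)
  then have "(tridiag_toeplitz n a b b *\<^sub>v u) $ i = a * u $ i + (if i = 0 then 0 else b * u $ (i - 1)) + b * ?p (Suc i)"
    using i by (subst tridiag_toeplitz_mult_vec_index) (simp_all add: u_def)
  also have "\<dots> = l * ?p i"
    unfolding rec using i by (simp add: u_def algebra_simps)
  finally show "(tridiag_toeplitz n a b b *\<^sub>v u) $ i = (l \<cdot>\<^sub>v u) $ i" using i by (simp add: u_def)
qed (simp add: u_def tridiag_toeplitz_def)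

text \<open>Evaluated at T, the Bezout identity loses its second summand, and on the kernel of
  \<open>g(T)\<close> also its first, so kernel vectors satisfy \<open>T w = l w\<close>. Conversely
  \<open>g(T)\<close> acts on \<open>x\<close> as the scalar \<open>g(l) = 0\<close>.\<close>

lemma poly_mat_tridiag_toeplitz_kernel:
  fixes a b :: "'a::field"
  assumes b: "b \<noteq> 0" and n: "0 < n"
    and bez: "u * g + v * toeplitz_poly a b n = [:-l, 1:]"
    and roots: "poly g l = 0" "poly (toeplitz_poly a b n) l = 0"
  defines "x \<equiv> vec n (\<lambda>k. poly (toeplitz_poly a b k) l)"
  shows "{w \<in> carrier_vec n. poly_mat g (tridiag_toeplitz n a b b) *\<^sub>v w = 0\<^sub>v n} = range (\<lambda>c. c \<cdot>\<^sub>v x)"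
proof (intro equalityI subsetI)
  let ?T = "tridiag_toeplitz n a b b"
  have T: "?T \<in> carrier_mat n n" by simp
  note [simp] = poly_mat_carrier[OF T]
  have x: "x \<in> carrier_vec n" by (simp add: x_def)
  {
    fix w assume "w \<in> {w \<in> carrier_vec n. poly_mat g ?T *\<^sub>v w = 0\<^sub>v n}"
    then have w: "w \<in> carrier_vec n" "poly_mat g ?T *\<^sub>v w = 0\<^sub>v n" by auto
    have "poly_mat [:-l, 1:] ?T *\<^sub>v w
        = (poly_mat u ?T * poly_mat g ?T) *\<^sub>v w + (poly_mat v ?T * 0\<^sub>m n n) *\<^sub>v w"
      unfolding bez[symmetric] poly_mat_add[OF T] poly_mat_mult[OF T] toeplitz_poly_annihilates[OF b n]
      using w(1) by (intro add_mult_distrib_mat_vec[of _ n n]) (auto intro!: mult_carrier_mat[of _ n n])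
    also have "(poly_mat u ?T * poly_mat g ?T) *\<^sub>v w = poly_mat u ?T *\<^sub>v (poly_mat g ?T *\<^sub>v w)"
      using w(1) poly_mat_carrier[OF T] by (intro assoc_mult_mat_vec[of _ n n _ n]) blast+
    also have "(poly_mat v ?T * 0\<^sub>m n n) *\<^sub>v w = 0\<^sub>v n"
      using w(1) by (subst right_mult_zero_mat[of _ n n]) auto
    finally have z: "poly_mat [:-l, 1:] ?T *\<^sub>v w = 0\<^sub>v n"
      using w(2) mult_mat_vec_carrier[OF poly_mat_carrier[OF T, of u] w(1)] by auto
    have "poly_mat [:-l, 1:] ?T *\<^sub>v w = (-l) \<cdot>\<^sub>v w + ?T *\<^sub>v w"
      unfolding poly_mat_linear[OF T] using T w(1)
      by (subst add_mult_distrib_mat_vec[of _ n n]) (auto simp: smult_mat_mult_mat_vec_assoc[of _ n n])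
    then have "(-l) \<cdot>\<^sub>v w + ?T *\<^sub>v w = 0\<^sub>v n" using z by simp
    then have "((-l) \<cdot>\<^sub>v w + ?T *\<^sub>v w) $ i = 0" if "i < n" for i using that by simp
    then have "?T *\<^sub>v w = l \<cdot>\<^sub>v w"
      using w(1) mult_mat_vec_carrier[OF T w(1)] by (intro eq_vecI) (auto simp del: index_mult_mat_vec)
    then have wk: "w $ k = w $ 0 * poly (toeplitz_poly a b k) l" if "k < n" for k
      using tridiag_toeplitz_eigenvector_unique[OF b w(1)] that by blast
    have "w = (w $ 0) \<cdot>\<^sub>v x"
    proof (rule eq_vecI)
      fix k assume "k < dim_vec ((w $ 0) \<cdot>\<^sub>v x)"
      then have k: "k < n" by (simp add: x_def)
      show "w $ k = ((w $ 0) \<cdot>\<^sub>v x) $ k" using k by (subst wk) (auto simp: x_def)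
    qed (use w(1) in \<open>simp add: x_def\<close>)
    then show "w \<in> range (\<lambda>c. c \<cdot>\<^sub>v x)" by blast
  }
  fix w assume "w \<in> range (\<lambda>c. c \<cdot>\<^sub>v x)"
  then obtain c where c: "w = c \<cdot>\<^sub>v x" by blast
  have "poly_mat g ?T *\<^sub>v x = 0 \<cdot>\<^sub>v x"
    using poly_mat_eigenvector[OF T x tridiag_toeplitz_eigenvector[OF b n roots(2), folded x_def], of g] roots
    by simp
  then have "poly_mat g ?T *\<^sub>v w = 0\<^sub>v n"
    using x unfolding c by (subst mult_mat_vec[of _ n n]) (auto simp: smult_smult_assoc)
  then show "w \<in> {w \<in> carrier_vec n. poly_mat g ?T *\<^sub>v w = 0\<^sub>v n}" using x c by simp
qed

section \<open>Codes and hulls\<close>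

text \<open>The dimension is the rank, and full rank is the independence of the columns. Their
  distinctness is a separate point since a set forgets repetitions: equal columns \<open>i\<close>
  and \<open>j\<close> would put the difference of two unit vectors into the kernel.\<close>

lemma linear_code_range_mat:
  fixes A :: "'a::field mat"
  assumes A: "A \<in> carrier_mat N k"
    and inj: "\<And>w. w \<in> carrier_vec k \<Longrightarrow> A *\<^sub>v w = 0\<^sub>v N \<Longrightarrow> w = 0\<^sub>v k"
  shows "linear_code N k ((\<lambda>w. A *\<^sub>v w) ` carrier_vec k)"
proof -
  interpret V: vec_space "TYPE('a)" N .
  have range: "(\<lambda>w. A *\<^sub>v w) ` carrier_vec k = V.span (set (cols A))"
    using V.col_space_eq[OF A] A unfolding V.col_space_def by (auto simp: image_def)
  have cols: "set (cols A) \<subseteq> carrier_vec N" using A cols_dim by blast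
  have dist: "distinct (cols A)"
  proof (rule ccontr)
    assume "\<not> distinct (cols A)"
    then obtain i j where ij: "i < k" "j < k" "i \<noteq> j" "col A i = col A j"
      using A by (auto simp: distinct_conv_nth)
    have "A *\<^sub>v (unit_vec k i - unit_vec k j) = A *\<^sub>v unit_vec k i - A *\<^sub>v unit_vec k j"
      using A by (intro mult_minus_distrib_mat_vec) auto
    also have "\<dots> = col A i - col A j"
    proof -
      have "A *\<^sub>v unit_vec k i = col A i" if "i < k" for i
        using A that by (intro eq_vecI) auto
      then show ?thesis using ij by simp
    qed
    also have "\<dots> = 0\<^sub>v N" using A ij by (intro eq_vecI) auto
    finally have "unit_vec k i - unit_vec k j = (0\<^sub>v k :: 'a vec)" by (intro inj) auto
    then have "(unit_vec k i - unit_vec k j) $ i = (0\<^sub>v k :: 'a vec) $ i" by simp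
    then show False using ij by simp
  qed
  have "V.lin_indpt (set (cols A))"
    using V.lin_depE[OF A _ dist] inj by blast
  then have "V.rank A = k" using V.lin_indpt_full_rank[OF A dist] by blast
  moreover have "VectorSpace.subspace class_ring (V.span (set (cols A))) V.V"
    using V.span_is_subspace[OF cols] by simp
  ultimately show ?thesis unfolding linear_code_def code_dim_def range V.rank_def by simp
qed

lemma generated_code_eq:
  assumes "G \<in> carrier_mat k N"
  shows "generated_code G = (\<lambda>w. transpose_mat G *\<^sub>v w) ` carrier_vec k"
proof -
  have "generated_code G = {w \<in> carrier_vec N. \<exists>y\<in>carrier_vec k. transpose_mat G *\<^sub>v y = w}"
    using assms vec_space.row_space_eq[OF assms] by (simp add: generated_code_def)
  then show ?thesis using assms by (auto simp: image_def)
qed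

text \<open>Moving \<open>transpose_mat G\<close> across the scalar product turns orthogonality to
  the code into orthogonality of the Gram matrix applied to \<open>w\<close> to all vectors; testing
  with unit vectors shows that this vector is zero.\<close>

lemma euclidean_hull_generated_code:
  fixes G :: "'a::field mat"
  assumes G: "G \<in> carrier_mat k N"
  shows "euclidean_hull N (generated_code G) =
    (\<lambda>w. transpose_mat G *\<^sub>v w) ` {w \<in> carrier_vec k. (G * transpose_mat G) *\<^sub>v w = 0\<^sub>v k}"
proof -
  have "(\<forall>x\<in>generated_code G. x \<bullet> (transpose_mat G *\<^sub>v w) = 0) \<longleftrightarrow>
      (G * transpose_mat G) *\<^sub>v w = 0\<^sub>v k" if w: "w \<in> carrier_vec k" for w
  proof -
    have Gt: "transpose_mat G \<in> carrier_mat N k" using G by simp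
    have "(transpose_mat G *\<^sub>v v) \<bullet> (transpose_mat G *\<^sub>v w) = v \<bullet> ((G * transpose_mat G) *\<^sub>v w)"
      if v: "v \<in> carrier_vec k" for v
      using transpose_vec_mult_scalar[OF G, of "transpose_mat G *\<^sub>v w" v] Gt w v
        assoc_mult_mat_vec[OF G Gt w]
        comm_scalar_prod[of "transpose_mat G *\<^sub>v v" N "transpose_mat G *\<^sub>v w"]
        comm_scalar_prod[of v k "G *\<^sub>v (transpose_mat G *\<^sub>v w)"]
        mult_mat_vec_carrier[OF G, of "transpose_mat G *\<^sub>v w"]
        mult_mat_vec_carrier[OF Gt v] mult_mat_vec_carrier[OF Gt w]
      by simp
    then have "(\<forall>x\<in>generated_code G. x \<bullet> (transpose_mat G *\<^sub>v w) = 0) \<longleftrightarrow>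
        (\<forall>v\<in>carrier_vec k. v \<bullet> ((G * transpose_mat G) *\<^sub>v w) = 0)"
      unfolding generated_code_eq[OF G] by simp
    also have "\<dots> \<longleftrightarrow> (G * transpose_mat G) *\<^sub>v w = 0\<^sub>v k"
    proof
      assume z: "\<forall>v\<in>carrier_vec k. v \<bullet> ((G * transpose_mat G) *\<^sub>v w) = 0"
      have c: "(G * transpose_mat G) *\<^sub>v w \<in> carrier_vec k"
        using G w by (intro mult_mat_vec_carrier[of _ k k] mult_carrier_mat[of _ k N]) auto
      show "(G * transpose_mat G) *\<^sub>v w = 0\<^sub>v k"
      proof (rule eq_vecI)
        fix i assume "i < dim_vec (0\<^sub>v k :: 'a vec)"
        then have i: "i < k" by simp
        show "((G * transpose_mat G) *\<^sub>v w) $ i = 0\<^sub>v k $ i"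
          using z[rule_format, of "unit_vec k i"] scalar_prod_left_unit[OF c i] i by simp
      qed (use carrier_vecD[OF c] in simp)
    next
      assume "(G * transpose_mat G) *\<^sub>v w = 0\<^sub>v k"
      then show "\<forall>v\<in>carrier_vec k. v \<bullet> ((G * transpose_mat G) *\<^sub>v w) = 0" by simp
    qed
    finally show ?thesis .
  qed
  moreover have "transpose_mat G *\<^sub>v w \<in> carrier_vec N" if "w \<in> carrier_vec k" for w
    using G that by simp
  ultimately show ?thesis
    unfolding euclidean_hull_def euclidean_dual_def using generated_code_eq[OF G] by auto
qed

section \<open>The Gram matrix of the generator matrix\<close>

lemma gen_mat_carrier [simp]: "gen_mat n t f A \<in> carrier_mat n (t * n)"
  by (simp add: gen_mat_def)

lemma gen_mat_mult_transpose:
  fixes A :: "'a::field mat"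
  assumes A: "A \<in> carrier_mat n n" and sym: "transpose_mat A = A" and t: "0 < t"
  shows "gen_mat n t f A * transpose_mat (gen_mat n t f A) = poly_mat (1 + (\<Sum>j=1..t-1. (f j)\<^sup>2)) A"
proof (rule eq_matI)
  let ?G = "gen_mat n t f A"
  \<comment> \<open>The identity block is the constant polynomial 1 evaluated at \<open>A\<close>,
    so all \<open>t\<close> blocks get the same shape. It contributes the summand 1.\<close>
  define h where "h = (\<lambda>j. if j = 0 then 1 else f j)"
  fix i k assume "i < dim_row (poly_mat (1 + (\<Sum>j=1..t-1. (f j)\<^sup>2)) A)"
    "k < dim_col (poly_mat (1 + (\<Sum>j=1..t-1. (f j)\<^sup>2)) A)"
  then have ik: "i < n" "k < n" using A by auto
  have block: "?G $$ (i, j * n + l) = poly_mat (h j) A $$ (i, l)" if "i < n" "j < t" "l < n" for i j l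
  proof -
    have "j * n + l < t * n"
      using that mult_le_mono1[of "Suc j" t n] by simp
    then show ?thesis using that A by (simp add: gen_mat_def h_def poly_mat_1[OF A])
  qed
  have "(?G * transpose_mat ?G) $$ (i, k) = (\<Sum>c<t * n. ?G $$ (i, c) * ?G $$ (k, c))"
    using ik carrier_matD[OF gen_mat_carrier, of n t f A]
    by (simp add: scalar_prod_def lessThan_atLeast0)
  also have "\<dots> = (\<Sum>j<t. \<Sum>c = j * n..<j * n + n. ?G $$ (i, c) * ?G $$ (k, c))"
    by (rule sum.nat_group[symmetric])
  also have "\<dots> = (\<Sum>j<t. \<Sum>l = 0..<n. ?G $$ (i, j * n + l) * ?G $$ (k, j * n + l))"
    using sum.shift_bounds_nat_ivl[of _ 0 _ n] by (simp add: add.commute atLeast0LessThan sum.atLeastLessThan_shift_0)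
  also have "\<dots> = (\<Sum>j<t. poly_mat ((h j)\<^sup>2) A $$ (i, k))"
  proof (rule sum.cong[OF refl])
    fix j assume "j \<in> {..<t}"
    then have "(\<Sum>l = 0..<n. ?G $$ (i, j * n + l) * ?G $$ (k, j * n + l))
        = (\<Sum>l = 0..<n. poly_mat (h j) A $$ (i, l) * transpose_mat (poly_mat (h j) A) $$ (l, k))"
      using ik A block by (intro sum.cong) auto
    also have "\<dots> = (poly_mat (h j) A * poly_mat (h j) A) $$ (i, k)"
      unfolding transpose_poly_mat[OF A sym] using ik A by (simp add: scalar_prod_def)
    finally show "(\<Sum>l = 0..<n. ?G $$ (i, j * n + l) * ?G $$ (k, j * n + l)) = poly_mat ((h j)\<^sup>2) A $$ (i, k)"
      by (simp add: poly_mat_mult[OF A] power2_eq_square)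
  qed
  also have "\<dots> = poly_mat (\<Sum>j<t. (h j)\<^sup>2) A $$ (i, k)"
    by (rule poly_mat_sum_index[OF A ik, symmetric])
  also have "(\<Sum>j<t. (h j)\<^sup>2) = 1 + (\<Sum>j=1..t-1. (f j)\<^sup>2)"
  proof -
    have "{..<t} = insert 0 {1..t-1}" using t by auto
    then show ?thesis by (simp add: h_def)
  qed
  finally show "(?G * transpose_mat ?G) $$ (i, k) = poly_mat (1 + (\<Sum>j=1..t-1. (f j)\<^sup>2)) A $$ (i, k)" .
qed (use A in \<open>auto simp: gen_mat_def\<close>)

text \<open>The encoding is systematic: a codeword starts with its message. This makes the encoding
  injective and the code of dimension \<open>n\<close>.\<close>

lemma gen_mat_transpose_mult_vec_index:
  fixes A :: "'a::field mat"
  assumes w: "w \<in> carrier_vec n" and i: "i < n" and t: "0 < t"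
  shows "(transpose_mat (gen_mat n t f A) *\<^sub>v w) $ i = w $ i"
proof -
  have "i < t * n" using i t by (metis less_le_trans mult_le_mono1 nat_mult_1 One_nat_def Suc_leI)
  then have "(transpose_mat (gen_mat n t f A) *\<^sub>v w) $ i = (\<Sum>k = 0..<n. if k = i then w $ k else 0)"
    using i w unfolding scalar_prod_def index_mult_mat_vec
    by (simp add: gen_mat_def scalar_prod_def if_distrib[of "\<lambda>x. x * _"] cong: if_cong)
  also have "\<dots> = w $ i" using i by simp
  finally show ?thesis .
qed

lemma toeplitz_code_one_dim_hull:
  fixes a b :: "'a::field"
  assumes b: "b \<noteq> 0" and n: "0 < n" and t: "0 < t"
    and bez: "u * (1 + (\<Sum>j=1..t-1. (f j)\<^sup>2)) + v * toeplitz_poly a b n = [:-l, 1:]"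
    and roots: "poly (1 + (\<Sum>j=1..t-1. (f j)\<^sup>2)) l = 0" "poly (toeplitz_poly a b n) l = 0"
  defines "C \<equiv> generated_code (gen_mat n t f (tridiag_toeplitz n a b b))"
  shows "linear_code (t * n) n C" and "code_dim (t * n) (euclidean_hull (t * n) C) = 1"
proof -
  let ?T = "tridiag_toeplitz n a b b"
  define G where "G = gen_mat n t f ?T"
  have G: "G \<in> carrier_mat n (t * n)" by (simp add: G_def)
  then have Gt: "transpose_mat G \<in> carrier_mat (t * n) n" by simp
  have inj: "w = 0\<^sub>v n" if "w \<in> carrier_vec n" "transpose_mat G *\<^sub>v w = 0\<^sub>v (t * n)" for w
  proof (rule eq_vecI)
    fix i assume "i < dim_vec (0\<^sub>v n :: 'a vec)"
    then have i: "i < n" by simp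
    then have "i < t * n" using t by (metis less_le_trans mult_le_mono1 nat_mult_1 One_nat_def Suc_leI)
    then show "w $ i = 0\<^sub>v n $ i"
      using gen_mat_transpose_mult_vec_index[OF that(1) i t, of f ?T] that(2) i by (simp add: G_def)
  qed (use that in simp)
  have C: "C = generated_code G" by (simp add: C_def G_def)
  show "linear_code (t * n) n C"
    unfolding C generated_code_eq[OF G] using Gt inj by (rule linear_code_range_mat)
  define x where "x = vec n (\<lambda>k. poly (toeplitz_poly a b k) l)"
  have x: "x \<in> carrier_vec n" by (simp add: x_def)
  define y where "y = transpose_mat G *\<^sub>v x"
  have y: "y \<in> carrier_vec (t * n)" unfolding y_def using Gt x by (rule mult_mat_vec_carrier)
  \<comment> \<open>Its entry at index 0 is \<open>P_0(l) = 1\<close>.\<close>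
  have "x \<noteq> 0\<^sub>v n"
  proof
    assume "x = 0\<^sub>v n"
    then have "x $ 0 = 0" using n by simp
    then show False using n by (simp add: x_def)
  qed
  then have y0: "y \<noteq> 0\<^sub>v (t * n)" using inj[OF x] by (auto simp: y_def)
  have "euclidean_hull (t * n) C = (\<lambda>w. transpose_mat G *\<^sub>v w) ` range (\<lambda>c. c \<cdot>\<^sub>v x)"
  proof -
    have "G * transpose_mat G = poly_mat (1 + (\<Sum>j=1..t-1. (f j)\<^sup>2)) ?T"
      unfolding G_def by (rule gen_mat_mult_transpose) (simp_all add: t transpose_tridiag_toeplitz)
    then show ?thesis
      unfolding C euclidean_hull_generated_code[OF G] x_def
      by (simp only: poly_mat_tridiag_toeplitz_kernel[OF b n bez roots])
  qed
  also have "\<dots> = range (\<lambda>c. c \<cdot>\<^sub>v y)"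
    using mult_mat_vec[OF Gt x] by (simp add: image_image y_def)
  \<comment> \<open>Written as the range of a one-column matrix, the line falls under the same
    dimension count as the code.\<close>
  also have "\<dots> = (\<lambda>w. mat_of_cols (t * n) [y] *\<^sub>v w) ` carrier_vec 1"
  proof -
    have col: "mat_of_cols (t * n) [y] *\<^sub>v w = (w $ 0) \<cdot>\<^sub>v y" if "w \<in> carrier_vec 1" for w
      using that y by (intro eq_vecI) (auto simp: mat_of_cols_def scalar_prod_def)
    have "c \<cdot>\<^sub>v y = mat_of_cols (t * n) [y] *\<^sub>v vec 1 (\<lambda>_. c)" for c
      by (subst col) simp_all
    then show ?thesis using col by (auto simp: image_def intro!: bexI[of _ "vec 1 _"])
  qed
  finally have hull: "euclidean_hull (t * n) C = (\<lambda>w. mat_of_cols (t * n) [y] *\<^sub>v w) ` carrier_vec 1" .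
  have "linear_code (t * n) 1 (euclidean_hull (t * n) C)"
    unfolding hull
  proof (rule linear_code_range_mat)
    show "mat_of_cols (t * n) [y] \<in> carrier_mat (t * n) 1"
      using mat_of_cols_carrier(1)[of "t * n" "[y]"] by simp
    fix w :: "'a vec"
    assume w: "w \<in> carrier_vec 1" "mat_of_cols (t * n) [y] *\<^sub>v w = 0\<^sub>v (t * n)"
    have "mat_of_cols (t * n) [y] *\<^sub>v w = (w $ 0) \<cdot>\<^sub>v y"
      using w(1) y by (intro eq_vecI) (auto simp: mat_of_cols_def scalar_prod_def)
    then have z: "(w $ 0) \<cdot>\<^sub>v y = 0\<^sub>v (t * n)" using w(2) by simp
    obtain i where i: "i < t * n" "y $ i \<noteq> 0" using y y0 by (auto simp: vec_eq_iff)
    have "((w $ 0) \<cdot>\<^sub>v y) $ i = 0" unfolding z using i by simp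
    then have "w $ 0 = 0" using i y by simp
    then show "w = 0\<^sub>v 1" using w(1) by (intro eq_vecI) (simp_all add: less_one)
  qed
  then show "code_dim (t * n) (euclidean_hull (t * n) C) = 1" by (simp add: linear_code_def)
qed

section \<open>Roots of $P_n$\<close>

text \<open>Clearing denominators gives a quadratic in \<open>z\<close> with constant term 1: it has
  a root in the closed field, and the root cannot be 0.\<close>

lemma inverse_param:
  fixes a b x :: "'a::alg_closed_field"
  assumes "b \<noteq> 0"
  obtains z where "z \<noteq> 0" "x = a - b * (z + inverse z)"
proof -
  obtain z where z: "poly [:1, (x - a) / b, 1:] z = 0"
    using alg_closed_imp_poly_has_root[of "[:1, (x - a) / b, 1:]"] by auto
  then have eq: "1 + z * ((x - a) / b + z) = 0" by simp
  then have z0: "z \<noteq> 0" by auto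
  have "z * ((x - a) / b + (z + inverse z)) = 1 + z * ((x - a) / b + z)"
    using z0 by (simp add: distrib_left)
  then have "(x - a) / b + (z + inverse z) = 0" using eq z0 by simp
  then have "(x - a) / b = - (z + inverse z)" by (simp only: add_eq_0_iff2)
  then have "x - a = b * (- (z + inverse z))" using assms by (simp add: field_simps)
  then have "x = a - b * (z + inverse z)" by (simp add: algebra_simps)
  with z0 show thesis by (rule that)
qed

lemma inverse_param_eq_iff:
  fixes a b :: "'a::field"
  assumes "b \<noteq> 0" "z \<noteq> 0" "w \<noteq> 0"
  shows "a - b * (z + inverse z) = a - b * (w + inverse w) \<longleftrightarrow> z = w \<or> z * w = 1"
proof -
  have "a - b * (z + inverse z) = a - b * (w + inverse w) \<longleftrightarrow> z + inverse z = w + inverse w"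
    using assms(1) by simp
  also have "\<dots> \<longleftrightarrow> z * w * (z + inverse z - (w + inverse w)) = 0"
    using assms by simp
  also have "z * w * (z + inverse z - (w + inverse w)) = (z - w) * (z * w - 1)"
    using assms by (simp add: algebra_simps mult.left_commute[of "inverse _"])
  finally show ?thesis by simp
qed

text \<open>By Frobenius \<open>w ^ q - 1 = (w - 1) ^ q\<close> for a power \<open>q\<close> of the
  characteristic, so that part of an exponent yields no new roots of unity.\<close>

lemma prime_char_power_eq_1:
  fixes w :: "'a::idom"
  assumes "Factorial_Ring.prime CHAR('a)" "w ^ (CHAR('a) ^ r) = 1"
  shows "w = 1"
proof -
  have "w ^ (CHAR('a) ^ r) = (1 + (w - 1)) ^ (CHAR('a) ^ r)" by simp
  also have "\<dots> = 1 + (w - 1) ^ (CHAR('a) ^ r)"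
    by (subst freshmans_dream'[OF assms(1) refl]) simp
  finally show ?thesis using assms(2) by simp
qed

text \<open>A root gives \<open>z ^ (2 (n + 1)) = 1\<close>, and Frobenius removes the power of the
  characteristic from the exponent. The condition is only necessary: \<open>z = 1\<close> and
  \<open>z = -1\<close> satisfy it whether or not the endpoint is a root.\<close>

lemma toeplitz_poly_root:
  fixes a b :: "'a::alg_closed_field"
  assumes b: "b \<noteq> 0" and p: "Factorial_Ring.prime CHAR('a)" and n: "n + 1 = CHAR('a) ^ r * k"
    and x: "poly (toeplitz_poly a b n) x = 0"
  obtains z where "z \<noteq> 0" "x = a - b * (z + inverse z)" "z ^ (2 * k) = 1"
proof -
  obtain z where z: "z \<noteq> 0" "x = a - b * (z + inverse z)"
    by (rule inverse_param[OF b])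
  have "z ^ Suc n = inverse z ^ Suc n"
    using poly_toeplitz_poly_param[OF b z(1), of a n] x by (simp add: z(2))
  then have "z ^ Suc n * z ^ Suc n = 1" using z(1) by (metis power_inverse power_not_zero left_inverse)
  then have "z ^ (Suc n + Suc n) = 1" by (simp only: power_add)
  also have "Suc n + Suc n = (2 * k) * CHAR('a) ^ r" using n by simp
  finally have "(z ^ (2 * k)) ^ (CHAR('a) ^ r) = 1" by (simp only: power_mult)
  then have "z ^ (2 * k) = 1" by (rule prime_char_power_eq_1[OF p])
  with z show thesis by (rule that)
qed

text \<open>Away from \<open>z * z = 1\<close> the factor \<open>z - inverse z\<close> can be
  cancelled, which gives the converse direction.\<close>

lemma toeplitz_poly_rootI:
  fixes a b :: "'a::field"
  assumes b: "b \<noteq> 0" and z: "z ^ (2 * (n + 1)) = 1" "z * z \<noteq> 1"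
  shows "poly (toeplitz_poly a b n) (a - b * (z + inverse z)) = 0"
proof -
  have z0: "z \<noteq> 0" using z(1) by (auto simp: power_0_left)
  have "2 * (n + 1) = Suc n + Suc n" by simp
  then have "z ^ Suc n * z ^ Suc n = 1" using z(1) by (simp only: power_add)
  then have "z ^ Suc n = inverse z ^ Suc n" by (metis inverse_unique power_inverse)
  then have "poly (toeplitz_poly a b n) (a - b * (z + inverse z)) * (z - inverse z) = 0"
    using poly_toeplitz_poly_param[OF b z0, of a n] by simp
  moreover have "z - inverse z \<noteq> 0" using z(2) z0 by (metis eq_iff_diff_eq_0 right_inverse)
  ultimately show ?thesis by simp
qed

section \<open>Powers of a primitive root of unity and simple roots by counting\<close>

lemma primitive_root_power_eq_iff:
  assumes "primitive_root_of_unity k z" "i < k" "j < k"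
  shows "z ^ i = z ^ j \<longleftrightarrow> i = j"
proof -
  have *: "i = j" if "z ^ i = z ^ j" "i \<le> j" "j < k" for i j
  proof (rule ccontr)
    assume "i \<noteq> j"
    have z0: "z \<noteq> 0" using assms(1) by (auto simp: primitive_root_of_unity_def power_0_left)
    have "z ^ j = z ^ i * z ^ (j - i)" using that by (metis le_add_diff_inverse power_add)
    then have "z ^ (j - i) = 1" using that(1) z0 by simp
    moreover have "0 < j - i" "j - i < k" using \<open>i \<noteq> j\<close> that by auto
    ultimately show False using assms(1) unfolding primitive_root_of_unity_def by blast
  qed
  show ?thesis using *[of i j] *[of j i] assms by (metis nat_le_linear)
qed

text \<open>The \<open>k\<close> powers of \<open>th\<close> are distinct roots of
  \<open>X^k - 1\<close>, which has at most \<open>k\<close> roots, so no others exist.\<close>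

lemma root_of_unity_eq_primitive_power:
  fixes z :: "'a::field"
  assumes th: "primitive_root_of_unity k th" and z: "z ^ k = 1"
  obtains i where "i < k" "z = th ^ i"
proof -
  have k: "0 < k" using th by (simp add: primitive_root_of_unity_def)
  define q where "q = Polynomial.monom (1::'a) k - 1"
  have deg: "Polynomial.degree q = k"
    using k unfolding q_def
    by (subst diff_conv_add_uminus, subst degree_add_eq_left) (auto simp: degree_monom_eq)
  then have q0: "q \<noteq> 0" using k by auto
  have roots: "{x. poly q x = 0} = {x. x ^ k = 1}" by (simp add: q_def poly_monom)
  have "(\<lambda>i. th ^ i) ` {..<k} \<subseteq> {x. x ^ k = 1}"
  proof clarify
    fix i
    have "(th ^ i) ^ k = (th ^ k) ^ i" by (simp only: mult.commute flip: power_mult)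
    then show "(th ^ i) ^ k = 1" using th by (simp add: primitive_root_of_unity_def)
  qed
  moreover have "card ((\<lambda>i. th ^ i) ` {..<k}) = k"
    using primitive_root_power_eq_iff[OF th] by (subst card_image) (auto simp: inj_on_def)
  moreover have "finite {x :: 'a. x ^ k = 1}" "card {x :: 'a. x ^ k = 1} \<le> k"
    using poly_roots_finite[OF q0] card_poly_roots_bound[OF q0] deg by (simp_all add: roots)
  ultimately have "(\<lambda>i. th ^ i) ` {..<k} = {x. x ^ k = 1}" by (intro card_seteq) auto
  with z have "z \<in> (\<lambda>i. th ^ i) ` {..<k}" by simp
  then show thesis using that by auto
qed

text \<open>If \<open>x\<close> were a double root, the cofactor of \<open>X - x\<close> would
  retain all the roots in \<open>S\<close> while its degree is one too small.\<close>

lemma simple_roots_if_card_roots_eq_degree: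
  fixes q :: "'a::idom poly"
  assumes q: "q \<noteq> 0" and S: "S \<subseteq> {x. poly q x = 0}" "card S = Polynomial.degree q"
  shows "{x. poly q x = 0} = S" and "poly q x = 0 \<Longrightarrow> poly (pderiv q) x \<noteq> 0"
proof -
  show eq: "{x. poly q x = 0} = S"
    using card_seteq[OF poly_roots_finite[OF q] S(1)] card_poly_roots_bound[OF q] S(2) by simp
  assume x: "poly q x = 0"
  then obtain e where e: "q = [:-x, 1:] * e" by (auto simp: poly_eq_0_iff_dvd elim: dvdE)
  then have e0: "e \<noteq> 0" using q by auto
  have deg: "Polynomial.degree q = Suc (Polynomial.degree e)"
    using e0 unfolding e by (subst degree_mult_eq) auto
  have "poly e x \<noteq> 0"
  proof
    assume "poly e x = 0"
    then have "S \<subseteq> {y. poly e y = 0}" using S(1) unfolding e by auto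
    then have "card S \<le> Polynomial.degree e"
      using card_mono[OF poly_roots_finite[OF e0]] card_poly_roots_bound[OF e0] by (meson le_trans)
    then show False using S(2) deg by simp
  qed
  moreover have "poly (pderiv q) x = poly e x"
    unfolding e by (simp add: pderiv_mult pderiv_pCons del: mult_pCons_left)
  ultimately show "poly (pderiv q) x \<noteq> 0" by simp
qed

lemma eval_ac_toeplitz_poly:
  "eval_ac (toeplitz_poly a b n) x = poly (toeplitz_poly (to_ac a) (to_ac b) n) x"
  by (simp add: eval_ac_def map_poly_toeplitz_poly)

lemma eval_ac_pderiv_toeplitz_poly:
  "eval_ac (pderiv (toeplitz_poly a b n)) x = poly (pderiv (toeplitz_poly (to_ac a) (to_ac b) n)) x"
  by (simp add: eval_ac_def to_ac.map_poly_pderiv map_poly_toeplitz_poly)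

section \<open>Divisibility of the binomial coefficient in the endpoint derivative\<close>

lemma six_times_choose_three: "6 * (Suc (Suc k) choose 3) = (k + 2) * (k + 1) * k"
proof -
  have "3 * (Suc (Suc k) choose 3) = Suc (Suc k) * (Suc k choose 2)"
    using Suc_times_binomial_eq[of "Suc k" 2] by (simp add: numeral_eq_Suc)
  moreover have "2 * (Suc k choose 2) = Suc k * k"
    using Suc_times_binomial_eq[of k 1] by (simp add: numeral_eq_Suc)
  ultimately have "2 * (3 * (Suc (Suc k) choose 3)) = Suc (Suc k) * (Suc k * k)"
    by (metis mult.left_commute)
  then show ?thesis by (simp add: algebra_simps)
qed

text \<open>Of the three consecutive factors only \<open>n + 1\<close> is even, and its single
  factor 2 cancels against the 6. This makes the derivative at the endpoint nonzero in
  characteristic 2.\<close>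

lemma not_dvd_choose_three_2:
  assumes "n + 1 = 2 * k" "odd k"
  shows "\<not> 2 dvd (Suc (Suc n) choose 3)"
proof
  assume "2 dvd (Suc (Suc n) choose 3)"
  then obtain c where c: "Suc (Suc n) choose 3 = 2 * c" by (elim dvdE)
  have "2 * (2 * (3 * c)) = 6 * (Suc (Suc n) choose 3)" using c by simp
  also have "\<dots> = 2 * ((n + 2) * k * n)"
    unfolding six_times_choose_three assms(1) by (simp only: ac_simps)
  finally have "2 * (3 * c) = (n + 2) * k * n" by simp
  then have "even ((n + 2) * k * n)" by (metis dvd_triv_left)
  moreover have "odd n" using assms(1) by (metis even_add even_mult_iff odd_one even_numeral)
  ultimately show False using assms(2) by simp
qed

text \<open>Only the middle one of three consecutive factors is divisible by 3, exactly once, and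
  that factor cancels against the 6. It serves the endpoints in characteristic 3.\<close>

lemma not_dvd_choose_three_3:
  assumes "n + 1 = 3 * k" "\<not> 3 dvd k"
  shows "\<not> 3 dvd (Suc (Suc n) choose 3)"
proof
  assume "3 dvd (Suc (Suc n) choose 3)"
  then obtain c where c: "Suc (Suc n) choose 3 = 3 * c" by (elim dvdE)
  have "3 * (3 * (2 * c)) = 6 * (Suc (Suc n) choose 3)" using c by simp
  also have "\<dots> = 3 * ((n + 2) * k * n)"
    unfolding six_times_choose_three assms(1) by (simp only: ac_simps)
  finally have "3 * (2 * c) = (n + 2) * k * n" by simp
  then have "3 dvd (n + 2) * k * n" by (metis dvd_triv_left)
  moreover have "Factorial_Ring.prime (3::nat)" by simp
  ultimately have "3 dvd n + 2 \<or> 3 dvd k \<or> 3 dvd n" by (metis prime_dvd_mult_iff)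
  then show False using assms by presburger
qed

text \<open>Interface between linear algebra and root counting: what remains in each case is to name
  the common root \<open>x0\<close> and to check that it is simple. Squares summing to
  \<open>-1\<close> means that \<open>g\<close> vanishes.\<close>

lemma toeplitz_code_one_dim_hull_simple_root:
  fixes a b :: "'a::field"
  assumes "b \<noteq> 0" "0 < n" "0 < t"
    and roots: "\<And>x. (\<Sum>j=1..t-1. (eval_ac (f j) x)\<^sup>2) = -1 \<and>
        poly (toeplitz_poly (to_ac a) (to_ac b) n) x = 0 \<longleftrightarrow> x = x0"
    and simple: "poly (pderiv (toeplitz_poly (to_ac a) (to_ac b) n)) x0 \<noteq> 0"
  defines "C \<equiv> generated_code (gen_mat n t f (tridiag_toeplitz n a b b))"
  shows "linear_code (t * n) n C \<and> code_dim (t * n) (euclidean_hull (t * n) C) = 1"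
proof -
  let ?g = "1 + (\<Sum>j=1..t-1. (f j)\<^sup>2)"
  have "eval_ac ?g x = 0 \<and> eval_ac (toeplitz_poly a b n) x = 0 \<longleftrightarrow> x = x0" for x
    using roots[of x] by (auto simp: eval_ac_sum eval_ac_toeplitz_poly add_eq_0_iff)
  moreover have "eval_ac (pderiv (toeplitz_poly a b n)) x0 \<noteq> 0"
    using simple by (simp add: eval_ac_pderiv_toeplitz_poly)
  ultimately obtain u v l where uv: "u * ?g + v * toeplitz_poly a b n = [:-l, 1:]"
      "poly ?g l = 0" "poly (toeplitz_poly a b n) l = 0"
    by (rule bezout_common_simple_root) blast
  show ?thesis unfolding C_def
    using toeplitz_code_one_dim_hull[OF assms(1-3) uv] by blast
qed

section \<open>The roots as points indexed by exponents\<close>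

lemma toeplitz_point_eq_iff:
  assumes "b \<noteq> 0" "\<theta> \<noteq> 0"
  shows "toeplitz_point a b \<theta> i = toeplitz_point a b \<theta> j \<longleftrightarrow> \<theta> ^ i = \<theta> ^ j \<or> \<theta> ^ (i + j) = 1"
  unfolding toeplitz_point_def using assms by (subst inverse_param_eq_iff) (auto simp: power_add)

text \<open>Complementary exponents give mutually inverse powers, so exponents in the upper half
  fold back to the lower half.\<close>

lemma toeplitz_point_complement:
  assumes "\<theta> ^ k = 1" "i \<le> k"
  shows "toeplitz_point a b \<theta> (k - i) = toeplitz_point a b \<theta> i"
proof -
  have "\<theta> ^ i * \<theta> ^ (k - i) = 1" using assms by (simp flip: power_add)
  then have "\<theta> ^ (k - i) = inverse (\<theta> ^ i)" by (metis inverse_unique)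
  then show ?thesis by (simp add: toeplitz_point_def)
qed

lemma toeplitz_poly_root_odd_char:
  fixes a b :: "'a::field"
  assumes b: "b \<noteq> 0" and p: "Factorial_Ring.prime CHAR('a)" and n: "n + 1 = CHAR('a) ^ r * (m + 1)"
    and th: "primitive_root_of_unity (2 * (m + 1)) \<theta>"
    and x: "poly (toeplitz_poly (to_ac a) (to_ac b) n) x = 0"
  obtains "x = to_ac (a - 2 * b)" | "x = to_ac (a + 2 * b)" | i where "1 \<le> i" "i \<le> m" "x = toeplitz_point a b \<theta> i"
proof -
  have b': "to_ac b \<noteq> 0" using b by simp
  obtain z where z: "z \<noteq> 0" "x = to_ac a - to_ac b * (z + inverse z)" "z ^ (2 * (m + 1)) = 1"
    using toeplitz_poly_root[OF b' _ _ x, of r "m + 1"] p n by (metis CHAR_alg_closure)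
  obtain i where i: "i < 2 * (m + 1)" "z = \<theta> ^ i"
    by (rule root_of_unity_eq_primitive_power[OF th z(3)])
  have xi: "x = toeplitz_point a b \<theta> i" using z(2) i(2) by (simp add: toeplitz_point_def)
  consider "i = 0" | "i = m + 1" | "1 \<le> i" "i \<le> m" | "m + 1 < i" by linarith
  then show thesis
  proof cases
    case 1
    then have "x = to_ac (a - 2 * b)" using z(2) i(2) by (simp add: algebra_simps)
    then show thesis by (rule that)
  next
    case 2
    have "z * z = \<theta> ^ (2 * (m + 1))" unfolding i(2) 2 mult_2 power_add ..
    then have "z * z = 1" using th by (simp add: primitive_root_of_unity_def)
    \<comment> \<open>Either sign leads to an endpoint, so the value of
      \<open>\<theta> ^ (m + 1)\<close> need not be decided.\<close>
    then have "z = 1 \<or> z = -1" by (simp add: square_eq_1_iff)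
    then have "x = to_ac (a - 2 * b) \<or> x = to_ac (a + 2 * b)"
      using z(2) by (auto simp: algebra_simps)
    then show thesis using that by blast
  next
    case 3
    then show thesis using xi by (rule that)
  next
    case 4
    have "x = toeplitz_point a b \<theta> (2 * (m + 1) - i)"
      using th i(1) xi by (subst toeplitz_point_complement) (auto simp: primitive_root_of_unity_def)
    then show thesis using 4 i(1) by (intro that(3)[of "2 * (m + 1) - i"]) auto
  qed
qed

text \<open>The \<open>m\<close> points are distinct roots of a polynomial of degree
  \<open>m\<close>, so they are all its roots and each is simple.\<close>

lemma toeplitz_poly_simple_roots:
  fixes a b :: "'a::field"
  assumes b: "b \<noteq> 0" and th: "primitive_root_of_unity (2 * (m + 1)) \<theta>"
  shows "{x. poly (toeplitz_poly (to_ac a) (to_ac b) m) x = 0} = toeplitz_point a b \<theta> ` {1..m}"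
    and "poly (toeplitz_poly (to_ac a) (to_ac b) m) x = 0 \<Longrightarrow>
      poly (pderiv (toeplitz_poly (to_ac a) (to_ac b) m)) x \<noteq> 0"
proof -
  let ?q = "toeplitz_poly (to_ac a) (to_ac b) m" and ?S = "toeplitz_point a b \<theta> ` {1..m}"
  have b': "to_ac b \<noteq> 0" using b by simp
  have deg: "Polynomial.degree ?q = m" using b' by (rule degree_toeplitz_poly)
  have one: "\<theta> ^ (2 * (m + 1)) = 1" and ne1: "\<And>j. 0 < j \<Longrightarrow> j < 2 * (m + 1) \<Longrightarrow> \<theta> ^ j \<noteq> 1"
    using th by (auto simp: primitive_root_of_unity_def)
  have th0: "\<theta> \<noteq> 0" using one by auto
  have "poly ?q (toeplitz_point a b \<theta> i) = 0" if "i \<in> {1..m}" for i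
    unfolding toeplitz_point_def
  proof (rule toeplitz_poly_rootI[OF b'])
    show "(\<theta> ^ i) ^ (2 * (m + 1)) = 1"
      using one by (metis mult.commute power_mult power_one)
    show "\<theta> ^ i * \<theta> ^ i \<noteq> 1" using ne1[of "i + i"] that by (simp add: power_add)
  qed
  then have sub: "?S \<subseteq> {x. poly ?q x = 0}" by auto
  have "inj_on (toeplitz_point a b \<theta>) {1..m}"
  proof (rule inj_onI)
    fix i j assume ij: "i \<in> {1..m}" "j \<in> {1..m}" "toeplitz_point a b \<theta> i = toeplitz_point a b \<theta> j"
    \<comment> \<open>Two points could also coincide through inverse powers, but
      \<open>0 < i + j < 2 * (m + 1)\<close> rules that out.\<close>
    then have "\<theta> ^ i = \<theta> ^ j" using toeplitz_point_eq_iff[OF b th0] ne1[of "i + j"] by fastforce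
    then show "i = j" using primitive_root_power_eq_iff[OF th] ij by auto
  qed
  then have "card ?S = Polynomial.degree ?q" by (simp add: card_image deg)
  moreover have "?q \<noteq> 0" using deg by (cases "m = 0") auto
  ultimately show "{x. poly ?q x = 0} = ?S" "poly ?q x = 0 \<Longrightarrow> poly (pderiv ?q) x \<noteq> 0"
    using simple_roots_if_card_roots_eq_degree[OF _ sub] by blast+
qed

lemma toeplitz_poly_root_char_2:
  fixes a b :: "'a::field"
  assumes b: "b \<noteq> 0" and p: "CHAR('a) = 2" and n: "n + 1 = 2 ^ r * (m + 1)" and m: "odd (m + 1)"
    and th: "primitive_root_of_unity (m + 1) \<theta>"
    and x: "poly (toeplitz_poly (to_ac a) (to_ac b) n) x = 0"
  obtains "x = to_ac a" | i where "1 \<le> i" "i \<le> m div 2" "x = toeplitz_point a b \<theta> i"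
proof -
  have b': "to_ac b \<noteq> 0" using b by simp
  have two: "CHAR('a alg_closure) = 2" using p by simp
  obtain z where z: "z \<noteq> 0" "x = to_ac a - to_ac b * (z + inverse z)" "z ^ (2 * (m + 1)) = 1"
    using toeplitz_poly_root[OF b' _ _ x, of r "m + 1"] n two by (metis two_is_prime_nat)
  \<comment> \<open>The remaining factor 2 of the exponent is itself the characteristic, so one more
    Frobenius step removes it.\<close>
  have "(z ^ (m + 1)) ^ (CHAR('a alg_closure) ^ 1) = 1"
    using z(3) unfolding two by (metis mult.commute power_mult power_one_right)
  then have z1: "z ^ (m + 1) = 1"
    by (rule prime_char_power_eq_1[rotated]) (simp add: p)
  obtain i where i: "i < m + 1" "z = \<theta> ^ i"
    by (rule root_of_unity_eq_primitive_power[OF th z1])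
  have xi: "x = toeplitz_point a b \<theta> i" using z(2) i(2) by (simp add: toeplitz_point_def)
  consider "i = 0" | "1 \<le> i" "i \<le> m div 2" | "m div 2 < i" by linarith
  then show thesis
  proof cases
    case 1
    have "(2 :: 'a alg_closure) = 0" using of_nat_CHAR[where ?'a = "'a alg_closure"] by (simp add: p)
    then have "x = to_ac a" using z(2) i(2) 1 by simp
    then show thesis by (rule that)
  next
    case 2
    then show thesis using xi by (rule that)
  next
    case 3
    have "x = toeplitz_point a b \<theta> (m + 1 - i)"
      using th i(1) xi by (subst toeplitz_point_complement) (auto simp: primitive_root_of_unity_def)
    \<comment> \<open>Here \<open>m\<close> must be even: for odd \<open>m\<close> the middle
      exponent would fold onto itself.\<close>
    moreover have "m + 1 - i \<le> m div 2" using 3 m i(1) by presburger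
    ultimately show thesis using i(1) by (intro that(2)[of "m + 1 - i"]) auto
  qed
qed

section \<open>One-dimensional hulls, by characteristic\<close>

lemma toeplitz_code_one_dim_hull_char_2:
  fixes a b :: "'a::field"
  assumes b: "b \<noteq> 0" and t: "0 < t" and p: "CHAR('a) = 2" and n: "n + 1 = 2 * (m + 1)" and m: "odd (m + 1)"
    and th: "primitive_root_of_unity (m + 1) \<theta>"
    and fa: "(\<Sum>j=1..t-1. poly (f j) a) = 1"
    and fi: "\<And>i. 1 \<le> i \<Longrightarrow> i \<le> m div 2 \<Longrightarrow> (\<Sum>j=1..t-1. eval_ac (f j) (toeplitz_point a b \<theta> i)) \<noteq> 1"
  defines "C \<equiv> generated_code (gen_mat n t f (tridiag_toeplitz n a b b))"
  shows "linear_code (t * n) n C \<and> code_dim (t * n) (euclidean_hull (t * n) C) = 1"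
proof -
  have b': "to_ac b \<noteq> 0" using b by simp
  have two: "CHAR('a alg_closure) = 2" using p by simp
  have two0: "(2 :: 'a alg_closure) = 0"
    using of_nat_CHAR[where ?'a = "'a alg_closure"] by (simp add: p)
  then have minus: "- 1 = (1 :: 'a alg_closure)"
    by (metis add_eq_0_iff2 one_add_one)
  \<comment> \<open>Frobenius turns the sum of squares into the square of the sum, and
    \<open>-1 = 1\<close> has the single square root 1. Hence the conditions in characteristic 2 are
    linear in the values of the polynomials.\<close>
  have sq: "(\<Sum>j=1..t-1. (eval_ac (f j) x)\<^sup>2) = -1 \<longleftrightarrow> (\<Sum>j=1..t-1. eval_ac (f j) x) = 1" for x
  proof -
    have "(\<Sum>j=1..t-1. (eval_ac (f j) x)\<^sup>2) = (\<Sum>j=1..t-1. eval_ac (f j) x)\<^sup>2"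
      by (rule freshmans_dream_sum[symmetric]) (simp_all add: p)
    then show ?thesis by (auto simp: minus power2_eq_1_iff)
  qed
  \<comment> \<open>In characteristic 2 both endpoints merge into \<open>a\<close>; this form makes
    the endpoint formulas applicable with \<open>e = 1\<close>.\<close>
  have end_point: "to_ac a = to_ac a + 2 * to_ac b * 1" by (simp add: two0)
  have val: "poly (toeplitz_poly (to_ac a) (to_ac b) n) (to_ac a) = 0"
    by (subst end_point, subst poly_toeplitz_poly_endpoint[OF b'])
       (use n in \<open>simp_all add: of_nat_eq_0_iff_char_dvd p del: of_nat_Suc\<close>)
  have "to_ac b * poly (pderiv (toeplitz_poly (to_ac a) (to_ac b) n)) (to_ac a)
      = of_nat (Suc (Suc n) choose 3)"
    by (subst end_point, subst poly_toeplitz_poly_endpoint(2)[OF b']) simp_all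
  also have "\<dots> \<noteq> 0"
    using not_dvd_choose_three_2[OF n m] unfolding of_nat_eq_0_iff_char_dvd two .
  finally have simple: "poly (pderiv (toeplitz_poly (to_ac a) (to_ac b) n)) (to_ac a) \<noteq> 0" by auto
  show ?thesis unfolding C_def
  proof (rule toeplitz_code_one_dim_hull_simple_root[OF b _ t _ simple])
    show "0 < n" using n by (cases n) auto
    fix x
    show "(\<Sum>j=1..t-1. (eval_ac (f j) x)\<^sup>2) = -1 \<and> poly (toeplitz_poly (to_ac a) (to_ac b) n) x = 0
        \<longleftrightarrow> x = to_ac a"
      unfolding sq
    proof (intro iffI)
      assume x: "(\<Sum>j=1..t-1. eval_ac (f j) x) = 1 \<and> poly (toeplitz_poly (to_ac a) (to_ac b) n) x = 0"
      have "n + 1 = 2 ^ 1 * (m + 1)" using n by simp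
      from toeplitz_poly_root_char_2[OF b p this m th conjunct2[OF x]]
      show "x = to_ac a" using x fi by blast
    next
      assume "x = to_ac a"
      then show "(\<Sum>j=1..t-1. eval_ac (f j) x) = 1 \<and> poly (toeplitz_poly (to_ac a) (to_ac b) n) x = 0"
        using val arg_cong[OF fa, of to_ac] by (simp add: to_ac_sum)
    qed
  qed
qed

text \<open>A primitive root of order \<open>2 * (n + 1)\<close> exists only if the characteristic
  does not divide that order. The \<open>n\<close> interior points then exhaust the roots, all of
  them simple.\<close>

lemma toeplitz_code_one_dim_hull_odd_char_coprime:
  fixes a b :: "'a::field"
  assumes b: "b \<noteq> 0" and n: "0 < n" and t: "0 < t"
    and th: "primitive_root_of_unity (2 * (n + 1)) \<theta>"
    and ex: "\<exists>!i. 1 \<le> i \<and> i \<le> n \<and> (\<Sum>j=1..t-1. (eval_ac (f j) (toeplitz_point a b \<theta> i))\<^sup>2) = -1"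
  defines "C \<equiv> generated_code (gen_mat n t f (tridiag_toeplitz n a b b))"
  shows "linear_code (t * n) n C \<and> code_dim (t * n) (euclidean_hull (t * n) C) = 1"
proof -
  note roots = toeplitz_poly_simple_roots[OF b th, of a]
  from ex obtain k where k: "1 \<le> k" "k \<le> n" "(\<Sum>j=1..t-1. (eval_ac (f j) (toeplitz_point a b \<theta> k))\<^sup>2) = -1"
    and uniq: "\<And>i. 1 \<le> i \<Longrightarrow> i \<le> n \<Longrightarrow>
      (\<Sum>j=1..t-1. (eval_ac (f j) (toeplitz_point a b \<theta> i))\<^sup>2) = -1 \<Longrightarrow> i = k"
    by blast
  have kroot: "poly (toeplitz_poly (to_ac a) (to_ac b) n) (toeplitz_point a b \<theta> k) = 0"
    using roots(1) k(1,2) by auto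
  show ?thesis unfolding C_def
  proof (rule toeplitz_code_one_dim_hull_simple_root[OF b n t _ roots(2)[OF kroot]])
    fix x
    show "(\<Sum>j=1..t-1. (eval_ac (f j) x)\<^sup>2) = -1 \<and> poly (toeplitz_poly (to_ac a) (to_ac b) n) x = 0
        \<longleftrightarrow> x = toeplitz_point a b \<theta> k"
    proof (intro iffI; (elim conjE)?)
      assume x: "(\<Sum>j=1..t-1. (eval_ac (f j) x)\<^sup>2) = -1" "poly (toeplitz_poly (to_ac a) (to_ac b) n) x = 0"
      then have "x \<in> toeplitz_point a b \<theta> ` {1..n}" using roots(1) by blast
      then obtain i where "1 \<le> i" "i \<le> n" "x = toeplitz_point a b \<theta> i" by auto
      then show "x = toeplitz_point a b \<theta> k" using uniq x(1) by blast
    qed (use k(3) kroot in simp)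
  qed
qed

lemma toeplitz_code_one_dim_hull_char_3:
  fixes a b :: "'a::field"
  assumes b: "b \<noteq> 0" and t: "0 < t" and p: "CHAR('a) = 3" and n: "n + 1 = 3 * (m + 1)" and m: "\<not> 3 dvd m + 1"
    and th: "primitive_root_of_unity (2 * (m + 1)) \<theta>"
    and ex: "\<exists>!x. x \<in> {a - 2 * b, a + 2 * b} \<and> (\<Sum>j=1..t-1. (poly (f j) x)\<^sup>2) = -1"
    and fi: "\<And>i. 1 \<le> i \<Longrightarrow> i \<le> m \<Longrightarrow> (\<Sum>j=1..t-1. (eval_ac (f j) (toeplitz_point a b \<theta> i))\<^sup>2) \<noteq> -1"
  defines "C \<equiv> generated_code (gen_mat n t f (tridiag_toeplitz n a b b))"
  shows "linear_code (t * n) n C \<and> code_dim (t * n) (euclidean_hull (t * n) C) = 1"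
proof -
  have b': "to_ac b \<noteq> 0" using b by simp
  have three: "CHAR('a alg_closure) = 3" using p by simp
  from ex obtain l where l: "l \<in> {a - 2 * b, a + 2 * b}" "(\<Sum>j=1..t-1. (poly (f j) l)\<^sup>2) = -1"
    and uniq: "\<And>x. x \<in> {a - 2 * b, a + 2 * b} \<Longrightarrow> (\<Sum>j=1..t-1. (poly (f j) x)\<^sup>2) = -1 \<Longrightarrow> x = l"
    by blast
  \<comment> \<open>The endpoint condition is stated in the base field while roots are compared in
    the closure; the embedding is injective.\<close>
  have transfer: "(\<Sum>j=1..t-1. (eval_ac (f j) (to_ac x))\<^sup>2) = -1 \<longleftrightarrow> (\<Sum>j=1..t-1. (poly (f j) x)\<^sup>2) = -1" for x
  proof -
    have "(\<Sum>j=1..t-1. (eval_ac (f j) (to_ac x))\<^sup>2) = to_ac (\<Sum>j=1..t-1. (poly (f j) x)\<^sup>2)"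
      by (simp add: to_ac_sum)
    moreover have "-1 = to_ac (-1 :: 'a)" by simp
    ultimately show ?thesis by (metis to_ac_eq_iff)
  qed
  \<comment> \<open>The sign \<open>e\<close> treats both endpoints at once.\<close>
  obtain e :: "'a alg_closure" where e: "e * e = 1" "to_ac l = to_ac a + 2 * to_ac b * e"
  proof -
    from l(1) consider "l = a + 2 * b" | "l = a - 2 * b" by blast
    then show thesis
    proof cases
      case 1
      then show thesis using that[of 1] by simp
    next
      case 2
      then show thesis using that[of "-1"] by simp
    qed
  qed
  have e0: "e \<noteq> 0" using e(1) by auto
  \<comment> \<open>The endpoint value is \<open>e ^ n\<close> times \<open>n + 1\<close>, so
    divisibility by 3 is what makes the endpoint a root.\<close>
  have "3 dvd Suc n" using n by (metis Suc_eq_plus1 dvd_triv_left)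
  then have "(of_nat (Suc n) :: 'a alg_closure) = 0"
    unfolding of_nat_eq_0_iff_char_dvd three .
  then have val: "poly (toeplitz_poly (to_ac a) (to_ac b) n) (to_ac l) = 0"
    unfolding e(2) poly_toeplitz_poly_endpoint(1)[OF b' e(1)] by (simp only: mult_zero_right)
  have "to_ac b * poly (pderiv (toeplitz_poly (to_ac a) (to_ac b) n)) (to_ac l)
      = e ^ Suc n * of_nat (Suc (Suc n) choose 3)"
    unfolding e(2) by (rule poly_toeplitz_poly_endpoint(2)[OF b' e(1)])
  moreover have "of_nat (Suc (Suc n) choose 3) \<noteq> (0 :: 'a alg_closure)"
    using not_dvd_choose_three_3[OF n m] unfolding of_nat_eq_0_iff_char_dvd three .
  ultimately have simple: "poly (pderiv (toeplitz_poly (to_ac a) (to_ac b) n)) (to_ac l) \<noteq> 0"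
    using e0 by (metis mult_eq_0_iff power_not_zero)
  show ?thesis unfolding C_def
  proof (rule toeplitz_code_one_dim_hull_simple_root[OF b _ t _ simple])
    show "0 < n" using n by (cases n) auto
    fix x
    show "(\<Sum>j=1..t-1. (eval_ac (f j) x)\<^sup>2) = -1 \<and> poly (toeplitz_poly (to_ac a) (to_ac b) n) x = 0
        \<longleftrightarrow> x = to_ac l"
    proof (intro iffI; (elim conjE)?)
      assume x: "(\<Sum>j=1..t-1. (eval_ac (f j) x)\<^sup>2) = -1" "poly (toeplitz_poly (to_ac a) (to_ac b) n) x = 0"
      have "Factorial_Ring.prime CHAR('a)" "n + 1 = CHAR('a) ^ 1 * (m + 1)" using p n by simp_all
      from toeplitz_poly_root_odd_char[OF b this th x(2)]
      consider y where "y \<in> {a - 2 * b, a + 2 * b}" "x = to_ac y"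
        | i where "1 \<le> i" "i \<le> m" "x = toeplitz_point a b \<theta> i" by blast
      then show "x = to_ac l"
      proof cases
        case 1
        then show ?thesis using uniq x(1) transfer by blast
      next
        case 2
        then show ?thesis using fi x(1) by blast
      qed
    next
      assume "x = to_ac l"
      then show "(\<Sum>j=1..t-1. (eval_ac (f j) x)\<^sup>2) = -1 \<and> poly (toeplitz_poly (to_ac a) (to_ac b) n) x = 0"
        using val l(2) transfer by blast
    qed
  qed
qed

theorem theorem4p13:
  fixes a b :: "'a::finite_field"
    and p n t r m :: nat
    and f :: "nat \<Rightarrow> 'a poly"
    and C :: "'a vec set"
  assumes "p = CHAR('a)"
    and "b \<noteq> 0"
    and "n \<ge> 2" and "t \<ge> 2"
    and "C = generated_code (gen_mat n t f (tridiag_toeplitz n a b b))"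
    and "n + 1 = p ^ r * (m + 1)"
    and "\<forall>r' m'. n + 1 = p ^ r' * (m' + 1) \<longrightarrow> r' \<le> r"
  shows
    "(p = 2 \<longrightarrow>
       (\<forall>\<theta>. primitive_root_of_unity (m + 1) \<theta> \<longrightarrow>
          r = 1 \<and>
          (\<Sum>j=1..t-1. poly (f j) a) = 1 \<and>
          (\<forall>i. 1 \<le> i \<and> i \<le> m div 2 \<longrightarrow>
             (\<Sum>j=1..t-1. eval_ac (f j) (toeplitz_point a b \<theta> i)) \<noteq> 1) \<longrightarrow>
          linear_code (t * n) n C \<and> code_dim (t * n) (euclidean_hull (t * n) C) = 1))
     \<and>
     (odd p \<longrightarrow>
       (\<forall>\<theta>. primitive_root_of_unity (2 * (m + 1)) \<theta> \<longrightarrow>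
          (r = 0 \<longrightarrow>
            ((\<exists>!i. 1 \<le> i \<and> i \<le> m \<and>
                (\<Sum>j=1..t-1. (eval_ac (f j) (toeplitz_point a b \<theta> i))\<^sup>2) = -1) \<longrightarrow>
              linear_code (t * n) n C \<and> code_dim (t * n) (euclidean_hull (t * n) C) = 1)
            \<and>
            (\<forall>\<mu>\<in>quadratic_extension. \<mu>\<^sup>2 = -1 \<longrightarrow> t = 2 \<longrightarrow>
              (\<exists>!i. 1 \<le> i \<and> i \<le> m \<and>
                 eval_ac (f 1) (toeplitz_point a b \<theta> i) \<in> {\<mu>, -\<mu>}) \<longrightarrow>
              linear_code (2 * n) n C \<and> code_dim (2 * n) (euclidean_hull (2 * n) C) = 1))
          \<and>
          (p = 3 \<and> r = 1 \<longrightarrow>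
            ((\<exists>!x. x \<in> {a - 2 * b, a + 2 * b} \<and> (\<Sum>j=1..t-1. (poly (f j) x)\<^sup>2) = -1) \<and>
             (\<forall>i. 1 \<le> i \<and> i \<le> m \<longrightarrow>
                (\<Sum>j=1..t-1. (eval_ac (f j) (toeplitz_point a b \<theta> i))\<^sup>2) \<noteq> -1) \<longrightarrow>
              linear_code (t * n) n C \<and> code_dim (t * n) (euclidean_hull (t * n) C) = 1)
            \<and>
            (\<forall>\<mu>\<in>quadratic_extension. \<mu>\<^sup>2 = -1 \<longrightarrow> t = 2 \<longrightarrow>
              (\<exists>!x. x \<in> {a - 2 * b, a + 2 * b} \<and> to_ac (poly (f 1) x) \<in> {\<mu>, -\<mu>}) \<and>
              (\<forall>i. 1 \<le> i \<and> i \<le> m \<longrightarrow>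
                 eval_ac (f 1) (toeplitz_point a b \<theta> i) \<notin> {\<mu>, -\<mu>}) \<longrightarrow>
              linear_code (2 * n) n C \<and> code_dim (2 * n) (euclidean_hull (2 * n) C) = 1))))"
proof (intro conjI impI allI ballI)
  have n: "0 < n" and t: "0 < t" using assms(3,4) by simp_all
  let ?P = "\<lambda>t. linear_code (t * n) n C \<and> code_dim (t * n) (euclidean_hull (t * n) C) = 1"
  have not_dvd: "\<not> p dvd m + 1"
  proof
    assume "p dvd m + 1"
    then obtain s where s: "m + 1 = p * s" by (elim dvdE)
    \<comment> \<open>Maximality of \<open>r\<close> is stated for cofactors of the form
      \<open>m' + 1\<close>; \<open>s\<close> is positive because \<open>p * s = m + 1\<close>, so
      \<open>m' = s - 1\<close> serves.\<close>
    then have "n + 1 = p ^ Suc r * (s - 1 + 1)" using assms(6) by (cases s) (auto simp: algebra_simps)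
    then have "Suc r \<le> r" using assms(7) by blast
    then show False by simp
  qed
  {
    fix \<theta> :: "'a alg_closure"
    assume p: "p = 2" and th: "primitive_root_of_unity (m + 1) \<theta>"
      and h: "r = 1 \<and> (\<Sum>j=1..t-1. poly (f j) a) = 1 \<and>
          (\<forall>i. 1 \<le> i \<and> i \<le> m div 2 \<longrightarrow>
             (\<Sum>j=1..t-1. eval_ac (f j) (toeplitz_point a b \<theta> i)) \<noteq> 1)"
    show "linear_code (t * n) n C" "code_dim (t * n) (euclidean_hull (t * n) C) = 1"
      using toeplitz_code_one_dim_hull_char_2[of b t n m \<theta> f a] assms(1,2,5,6) not_dvd t p th h by auto
  }
  {
    fix \<theta> :: "'a alg_closure"
    assume th: "primitive_root_of_unity (2 * (m + 1)) \<theta>"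
    {
      assume "r = 0"
      then have m: "m = n" using assms(6) by simp
      have main: "?P t"
        if "\<exists>!i. 1 \<le> i \<and> i \<le> m \<and> (\<Sum>j=1..t-1. (eval_ac (f j) (toeplitz_point a b \<theta> i))\<^sup>2) = -1"
        using toeplitz_code_one_dim_hull_odd_char_coprime[OF assms(2) n t, of \<theta> f a] th that
        unfolding m assms(5) by blast
      then show "linear_code (t * n) n C" "code_dim (t * n) (euclidean_hull (t * n) C) = 1"
        if "\<exists>!i. 1 \<le> i \<and> i \<le> m \<and> (\<Sum>j=1..t-1. (eval_ac (f j) (toeplitz_point a b \<theta> i))\<^sup>2) = -1"
        using that by blast+
      fix \<mu> :: "'a alg_closure"
      assume mu: "\<mu>\<^sup>2 = -1" and t2: "t = 2"
        and ex: "\<exists>!i. 1 \<le> i \<and> i \<le> m \<and> eval_ac (f 1) (toeplitz_point a b \<theta> i) \<in> {\<mu>, -\<mu>}"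
      \<comment> \<open>The set consists of the two square roots of \<open>-1\<close>, so for
        \<open>t = 2\<close> membership is the one-term case of the condition on sums of
        squares.\<close>
      have "y \<in> {\<mu>, -\<mu>} \<longleftrightarrow> y\<^sup>2 = -1" for y using mu by (metis insert_iff power2_eq_iff singletonD)
      then have "?P t" using main ex t2 by simp
      then show "linear_code (2 * n) n C" "code_dim (2 * n) (euclidean_hull (2 * n) C) = 1"
        using t2 by simp_all
    }
    {
      assume p: "p = 3 \<and> r = 1"
      have main: "?P t"
        if "\<exists>!x. x \<in> {a - 2 * b, a + 2 * b} \<and> (\<Sum>j=1..t-1. (poly (f j) x)\<^sup>2) = -1"
          and "\<forall>i. 1 \<le> i \<and> i \<le> m \<longrightarrow> (\<Sum>j=1..t-1. (eval_ac (f j) (toeplitz_point a b \<theta> i))\<^sup>2) \<noteq> -1"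
        unfolding assms(5)
        by (rule toeplitz_code_one_dim_hull_char_3[OF assms(2) t _ _ _ th that(1)])
           (use p assms(1,6) not_dvd that(2) in auto)
      then show "linear_code (t * n) n C" "code_dim (t * n) (euclidean_hull (t * n) C) = 1"
        if "(\<exists>!x. x \<in> {a - 2 * b, a + 2 * b} \<and> (\<Sum>j=1..t-1. (poly (f j) x)\<^sup>2) = -1) \<and>
             (\<forall>i. 1 \<le> i \<and> i \<le> m \<longrightarrow>
                (\<Sum>j=1..t-1. (eval_ac (f j) (toeplitz_point a b \<theta> i))\<^sup>2) \<noteq> -1)"
        using that by blast+
      fix \<mu> :: "'a alg_closure"
      assume mu: "\<mu>\<^sup>2 = -1" and t2: "t = 2"
        and ex: "(\<exists>!x. x \<in> {a - 2 * b, a + 2 * b} \<and> to_ac (poly (f 1) x) \<in> {\<mu>, -\<mu>}) \<and>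
              (\<forall>i. 1 \<le> i \<and> i \<le> m \<longrightarrow> eval_ac (f 1) (toeplitz_point a b \<theta> i) \<notin> {\<mu>, -\<mu>})"
      have sq: "y \<in> {\<mu>, -\<mu>} \<longleftrightarrow> y\<^sup>2 = -1" for y using mu by (metis insert_iff power2_eq_iff singletonD)
      \<comment> \<open>Since \<open>\<mu>\<close> may lie outside the base field, membership is
        first rewritten as \<open>y\<^sup>2 = -1\<close>, which descends along the
        embedding.\<close>
      have to_ac_sq: "to_ac y \<in> {\<mu>, -\<mu>} \<longleftrightarrow> y\<^sup>2 = -1" for y :: 'a
        unfolding sq by (metis to_ac_1 to_ac_eq_iff to_ac_minus to_ac_power)
      have "?P t" using ex unfolding to_ac_sq unfolding sq by (intro main) (simp_all add: t2)
      then show "linear_code (2 * n) n C" "code_dim (2 * n) (euclidean_hull (2 * n) C) = 1"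
        using t2 by simp_all
    }
  }
qed

end
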